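(* Let $M^{m} \subset \mathbb{C}^n$ be a connected full complex submanifold of complex dimension $m$. Assume that $M$ is a helix of angle $\theta$ with respect to a direction $d \in \mathbb{C}^n$, $d\ne 0$. Then $\theta = 0$, and so $M$ is locally an extrinsic product $$M = \mathbb{C} \times N \subset \mathbb{C} \times \mathbb{C}^{n-1},$$ where $N \subset \mathbb{C}^{n-1}$ is a complex submanifold.
   Context: Identify $\mathbb{C}^n$ with Euclidean space $\mathbb{R}^{2n}$. For a submanifold $M$ and a nonzero vector $d$, write $d=d^{\top}+d^{\perp}$ for the decomposition of $d$ at $p\in M$ into components tangent and normal to $M$. $M$ is a helix of angle $\theta$ with respect to $d$ if the angle $\angle(T_pM,d)\in[0,\pi/2]$, determined by $\|d^{\top}\|=\|d\|\cos\angle(T_pM,d)$, equals the constant $\theta$ for all $p\in M$. $M$ is full if it is not contained in an affine hyperplane. "Locally an extrinsic product $\mathbb{C}\times N\subset\mathbb{C}\times\mathbb{C}^{n-1}$" means that near each point, and after a unitary change of coordinates splitting $\mathbb{C}^n=\mathbb{C}\times\mathbb{C}^{n-1}$ orthogonally with first factor the complex line spanned by $d$, $M$ coincides with an open part of such a product. The helix is not assumed to be ruled. *)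

theory Defs
  imports "HOL-Analysis.Analysis"
begin

(* Throughout, C^n is the type complex^'n.  Its real inner product, norm and topology are those
   of R^(2n); its complex structure is scalar multiplication by *s, with vec.subspace, vec.span
   and vec.dim taken over the complex numbers. *)

(* Meant for S relatively open in a complex subspace H of C^n: the derivative is taken within S,
   so only its restriction to H matters; for H = UNIV this is complex Frechet differentiability. *)
definition holomorphic_map_on :: "(complex^'n \<Rightarrow> complex^'k) \<Rightarrow> (complex^'n) set \<Rightarrow> bool"
  where "holomorphic_map_on f S \<longleftrightarrow>
    (\<forall>z\<in>S. \<exists>D. Vector_Spaces.linear (*s) (*s) D \<and> (f has_derivative D) (at z within S))"

(* Embedded complex submanifolds of complex dimension m of a complex subspace H: near each of its
   points M is straightened to a complex m-plane L by a biholomorphism F between open subsets of H.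
   The ambient H = UNIV gives submanifolds of C^n; a proper H serves as C^k with k < n (there is no
   index type for C^0), where k = 0 or m = 0 is allowed. *)
definition complex_submanifold :: "(complex^'n) set \<Rightarrow> nat \<Rightarrow> (complex^'n) set \<Rightarrow> bool"
  where "complex_submanifold H m M \<longleftrightarrow> vec.subspace H \<and> M \<subseteq> H \<and>
    (\<forall>p\<in>M. \<exists>U V L F G.
       p \<in> U \<and> openin (top_of_set H) U \<and> openin (top_of_set H) V \<and>
       vec.subspace L \<and> L \<subseteq> H \<and> vec.dim L = m \<and>
       homeomorphism U V F G \<and> holomorphic_map_on F U \<and> holomorphic_map_on G V \<and>
       F ` (M \<inter> U) = L \<inter> V)"

(* Velocities at p of curves in M.  Differentiability is only asked at 0; for an embedded
   submanifold, smooth curves give the same set. *)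
definition tangent_space :: "'a::real_normed_vector set \<Rightarrow> 'a \<Rightarrow> 'a set"
  where "tangent_space M p =
    {v. \<exists>\<gamma> \<epsilon>. \<epsilon> > 0 \<and> \<gamma> ` {-\<epsilon><..<\<epsilon>} \<subseteq> M \<and> \<gamma> (0::real) = p \<and>
         (\<gamma> has_vector_derivative v) (at 0)}"

(* The witnesses u and w are the components of d in T and orthogonal to T. *)
definition has_angle :: "'a::real_inner set \<Rightarrow> 'a \<Rightarrow> real \<Rightarrow> bool"
  where "has_angle T d \<theta> \<longleftrightarrow> \<theta> \<in> {0..pi/2} \<and>
    (\<exists>u w. d = u + w \<and> u \<in> T \<and> (\<forall>v\<in>T. orthogonal w v) \<and> norm u = norm d * cos \<theta>)"

definition helix :: "'a::real_inner set \<Rightarrow> real \<Rightarrow> 'a \<Rightarrow> bool"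
  where "helix M \<theta> d \<longleftrightarrow> (\<forall>p\<in>M. has_angle (tangent_space M p) d \<theta>)"

(* Hyperplanes are real ones, of R^(2n) when applied to C^n. *)
definition full :: "'a::real_inner set \<Rightarrow> bool"
  where "full M \<longleftrightarrow> \<not> (\<exists>a b. a \<noteq> 0 \<and> M \<subseteq> {x. a \<bullet> x = b})"

definition conjugate_transpose :: "complex^'n^'k \<Rightarrow> complex^'k^'n"
  where "conjugate_transpose A = (\<chi> i j. cnj (A $ j $ i))"

definition unitary :: "complex^'n^'n \<Rightarrow> bool"
  where "unitary A \<longleftrightarrow>
    A ** conjugate_transpose A = mat 1 \<and> conjugate_transpose A ** A = mat 1"

(* In the unitary coordinates z |-> A *v z, the factor C of C^n = C x C^(n-1) is the i-th
   coordinate axis, which corresponds to the complex line spanned by d, and C^(n-1) is the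
   hyperplane of vectors with vanishing i-th coordinate. *)
definition locally_extrinsic_product :: "nat \<Rightarrow> (complex^'n) set \<Rightarrow> complex^'n \<Rightarrow> bool"
  where "locally_extrinsic_product m M d \<longleftrightarrow>
    (\<exists>A i. unitary A \<and> (*v) A ` vec.span {d} = vec.span {axis i 1} \<and>
      (\<forall>p\<in>M. \<exists>W N. open W \<and> A *v p \<in> W \<and>
         complex_submanifold {w. w $ i = 0} (m - 1) N \<and>
         (*v) A ` M \<inter> W = {axis i c + w | c w. w \<in> N} \<inter> W))"

end

theory Submission
  imports Defs "HOL-Complex_Analysis.Conformal_Mappings"
begin

text \<open>Write \<open>d = \<tau> + \<xi>\<close> for the tangential and normal part of \<open>d\<close> at a point of \<open>M\<close>, and
  write \<open>M\<close> near that point as a graph over its tangent space, with \<open>G x\<close> the derivative of the graph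
  function. The tangential part of \<open>d\<close> over \<open>x\<close> is \<open>u + G x u\<close> with
  \<open>(1 + (G x)\<^sup>* G x) u = \<tau> + (G x)\<^sup>* \<xi>\<close>, and the helix condition says that
  \<open>\<langle>u, \<tau> + (G x)\<^sup>* \<xi>\<rangle>\<close> is constant. This is a real-analytic identity, so it may be polarized: it
  persists when \<open>(G x)\<^sup>*\<close> is replaced by \<open>(G y)\<^sup>*\<close> in the equation for \<open>u\<close>, with \<open>x\<close> and \<open>y\<close>
  independent. With \<open>Q\<close> the second fundamental form and \<open>\<langle>Z, A X\<rangle> = \<langle>Q(X, Z), \<xi>\<rangle>\<close>, its lowest
  order terms read \<open>\<langle>A Y, A X\<rangle> = \<langle>Q(X, \<tau>), Q(Y, \<tau>)\<rangle>\<close> and \<open>\<langle>Q(\<tau>, A Y), Q(\<tau>, Y)\<rangle> = 0\<close>, which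
  together with the symmetry of \<open>Q\<close> force \<open>A = 0\<close> and \<open>Q(\<sqdot>, \<tau>) = 0\<close>. Hence the tangential
  part of \<open>d\<close> is constant along \<open>M\<close>, and so is the normal part \<open>\<xi>\<close>; then \<open>M\<close> lies in a hyperplane
  orthogonal to \<open>\<xi>\<close>, so that fullness gives \<open>\<xi> = 0\<close>. Thus \<open>d\<close> is tangent to \<open>M\<close>
  everywhere, and the graph functions are invariant under translation along \<open>d\<close>.\<close>

section \<open>Regularity of holomorphic maps in several variables\<close>

lemma norm_vector_scalar_mult: "norm (c *s x) = norm c * norm x" for x :: "complex^'n"
proof -
  have "norm (c *s x) = L2_set (\<lambda>i. norm c * norm (x $ i)) UNIV"
    by (simp add: norm_vec_def norm_mult)
  also have "\<dots> = norm c * norm x"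
    by (subst L2_set_right_distrib[symmetric]) (auto simp: norm_vec_def)
  finally show ?thesis .
qed

lemma scaleR_eq_vector_scalar_mult: "r *\<^sub>R x = of_real r *s x" for x :: "complex^'n"
  by (vector scaleR_conv_of_real)

lemma bounded_linear_vector_scalar_mult_left: "bounded_linear (\<lambda>c. c *s x)" for x :: "complex^'n"
  by (rule bounded_linear_intro[where K = "norm x"])
     (auto simp: vec_eq_iff algebra_simps norm_vector_scalar_mult)

lemma continuous_on_vector_scalar_mult_left [continuous_intros]:
  "continuous_on S f \<Longrightarrow> continuous_on S (\<lambda>z. f z *s x)" for x :: "complex^'n"
  using bounded_linear.continuous_on[OF bounded_linear_vector_scalar_mult_left] .

text \<open>Cauchy's inequality on circles of radius \<open>\<rho>/3\<close> about points of the
  closed half disc bounds the second derivative by \<open>2! * 9 * B / \<rho>^2\<close>; this is the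
  18 in the remainder of Taylor's formula.\<close>

lemma quadratic_Taylor_bound:
  assumes hol: "\<phi> holomorphic_on ball 0 \<rho>" and B: "\<And>z. z \<in> ball 0 \<rho> \<Longrightarrow> norm (\<phi> z) \<le> B"
    and \<rho>: "\<rho> > 0" and z: "norm z \<le> \<rho> / 2"
  shows "norm (\<phi> z - \<phi> 0 - z * deriv \<phi> 0) \<le> 18 * B / \<rho>^2 * norm z ^ 2"
proof -
  define f where "f i = (deriv ^^ i) \<phi>" for i
  have d: "(f i has_field_derivative f (Suc i) x) (at x within cball 0 (\<rho>/2))"
    if "x \<in> cball 0 (\<rho>/2)" for i x
  proof -
    have "x \<in> ball 0 \<rho>"
      using that \<rho> by auto
    moreover have "f i holomorphic_on ball 0 \<rho>"
      unfolding f_def by (intro holomorphic_higher_deriv hol) auto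
    ultimately have "(f i has_field_derivative deriv (f i) x) (at x)"
      by (simp add: holomorphic_derivI)
    then show ?thesis
      by (simp add: f_def has_field_derivative_at_within)
  qed
  have b: "cmod (f (Suc 1) x) \<le> 18 * B / \<rho>^2" if "x \<in> cball 0 (\<rho>/2)" for x
  proof -
    have sub: "cball x (\<rho>/3) \<subseteq> ball 0 \<rho>"
    proof
      fix y assume "y \<in> cball x (\<rho>/3)"
      then have "norm y \<le> norm x + \<rho>/3"
        by (metis dist_norm mem_cball norm_minus_commute norm_triangle_sub add_left_mono order_trans)
      with that \<rho> show "y \<in> ball 0 \<rho>" by auto
    qed
    have "norm ((deriv ^^ 2) \<phi> x) \<le> fact 2 * B / (\<rho>/3)^2"
    proof (rule Cauchy_inequality)
      show "\<phi> holomorphic_on ball x (\<rho>/3)"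
        using hol sub by (meson ball_subset_cball holomorphic_on_subset order_trans)
      show "continuous_on (cball x (\<rho>/3)) \<phi>"
        using hol sub holomorphic_on_imp_continuous_on holomorphic_on_subset by blast
      show "norm (\<phi> y) \<le> B" if "norm (x - y) = \<rho>/3" for y
        using that sub B by (auto simp: dist_norm subset_iff)
    qed (use \<rho> in auto)
    then show ?thesis
      by (simp add: f_def numeral_2_eq_2 field_simps)
  qed
  have "cmod (f 0 z - (\<Sum>i\<le>1. f i 0 * (z-0) ^ i / (fact i))) \<le> 18 * B / \<rho>^2 * cmod(z - 0)^(Suc 1) / fact 1"
    by (rule complex_Taylor[of "cball 0 (\<rho>/2)"]) (use d b z \<rho> in auto)
  then show ?thesis
    by (simp add: f_def algebra_simps numeral_2_eq_2)
qed

text \<open>Recentring: the hypothesis speaks of the parameter value 0 at every base point of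
  \<open>S\<close>, and moving the base point to \<open>x + l *s Y\<close> turns it into a statement
  about the value \<open>l\<close>.\<close>

lemma line_holomorphic:
  fixes f :: "complex^'n \<Rightarrow> complex"
  assumes "\<And>x Y. x \<in> S \<Longrightarrow> ((\<lambda>l. f (x + l *s Y)) has_field_derivative D x Y) (at 0)"
    and "x + l *s Y \<in> S"
  shows "((\<lambda>l. f (x + l *s Y)) has_field_derivative D (x + l *s Y) Y) (at l)"
proof -
  have *: "((\<lambda>k. f ((x + l *s Y) + k *s Y)) has_field_derivative D (x + l *s Y) Y) (at (l - l))"
    using assms by simp
  have "((\<lambda>m. f ((x + l *s Y) + (m - l) *s Y)) has_field_derivative D (x + l *s Y) Y) (at l)"
    using DERIV_chain2[where g = "\<lambda>m. m - l" and Db = 1 and x = l and s = UNIV, OF *]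
      DERIV_diff[OF DERIV_ident DERIV_const, of l l UNIV] by simp
  then show ?thesis
    by (simp add: vec.scale_left_diff_distrib)
qed

text \<open>One-variable Cauchy estimates on the complex lines through \<open>x\<close>. Normalizing
  the direction to a unit vector makes the constants independent of it, and this uniformity later
  yields total differentiability from differentiability along lines.\<close>

lemma line_holomorphic_bounds:
  fixes f :: "complex^'n \<Rightarrow> complex"
  assumes f: "\<And>x Y. x \<in> ball x0 R \<Longrightarrow> ((\<lambda>l. f (x + l *s Y)) has_field_derivative D x Y) (at 0)"
    and B: "\<And>x. x \<in> ball x0 R \<Longrightarrow> norm (f x) \<le> B"
    and scal: "\<And>x c Y. x \<in> ball x0 R \<Longrightarrow> D x (c *s Y) = c * D x Y"
    and x: "x \<in> ball x0 (R/2)"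
  shows "norm Y \<le> R/4 \<Longrightarrow> norm (f (x + Y) - f x - D x Y) \<le> 72 * B / R^2 * norm Y ^ 2"
    and "norm (D x Y) \<le> 4 * B / R * norm Y"
proof -
  have R: "R > 0"
    using x zero_le_dist[of x0 x] unfolding mem_ball by linarith
  have "x \<in> ball x0 R" using x R by auto
  have in_ball: "x + l *s U \<in> ball x0 R" if "norm U = 1" "l \<in> ball 0 (R/2)" for l U
  proof -
    have "norm (l *s U) < R/2" using that by (simp add: norm_vector_scalar_mult)
    then have "dist x0 (x + l *s U) < R/2 + R/2"
      using x by (smt (verit) dist_norm diff_add_cancel add_diff_cancel_left' dist_triangle mem_ball dist_commute)
    then show ?thesis by simp
  qed
  \<comment> \<open>The disc of radius \<open>R/2\<close> on each line turns the 18 of the Taylor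
    bound into 72, and the circle of radius \<open>R/4\<close> gives
    \<open>4 * B / R\<close>.\<close>
  have main: "norm (D x U) \<le> 4 * B / R \<and> (norm l \<le> R/4 \<longrightarrow> 
      norm (f (x + l *s U) - f x - l * D x U) \<le> 72 * B / R^2 * norm l ^ 2)" if U: "norm U = 1" for U l
  proof -
    define \<phi> where "\<phi> l = f (x + l *s U)" for l
    have der: "(\<phi> has_field_derivative D (x + l *s U) U) (at l)" if "l \<in> ball 0 (R/2)" for l
      unfolding \<phi>_def by (rule line_holomorphic[OF f in_ball[OF U that]])
    have hol: "\<phi> holomorphic_on ball 0 (R/2)"
      using der unfolding holomorphic_on_open[OF open_ball] by blast
    have b: "norm (\<phi> z) \<le> B" if "z \<in> ball 0 (R/2)" for z
      using B in_ball[OF U that] by (simp add: \<phi>_def)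
    have d0: "deriv \<phi> 0 = D x U"
      using der[of 0] R by (simp add: DERIV_imp_deriv)
    have "norm ((deriv ^^ 1) \<phi> 0) \<le> fact 1 * B / (R/4)^1"
    proof (rule Cauchy_inequality)
      have sub: "cball (0::complex) (R/4) \<subseteq> ball 0 (R/2)" using R by auto
      show "\<phi> holomorphic_on ball 0 (R/4)"
        using hol sub by (meson ball_subset_cball holomorphic_on_subset order_trans)
      show "continuous_on (cball 0 (R/4)) \<phi>"
        using hol sub holomorphic_on_imp_continuous_on holomorphic_on_subset by blast
      show "norm (\<phi> y) \<le> B" if "norm (0 - y) = R/4" for y
        using that b R by auto
    qed (use R in auto)
    moreover have "norm (\<phi> l - \<phi> 0 - l * deriv \<phi> 0) \<le> 18 * B / (R/2)^2 * norm l ^ 2" if "norm l \<le> R/4"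
      by (rule quadratic_Taylor_bound[OF hol b]) (use that R in auto)
    ultimately show ?thesis
      by (auto simp: d0 \<phi>_def field_simps)
  qed
  have B0: "B \<ge> 0" using B[of x] x R norm_ge_zero order_trans \<open>x \<in> ball x0 R\<close> by blast
  define U where "U = of_real (1 / norm Y) *s Y"
  have U: "norm U = 1" "of_real (norm Y) *s U = Y" if "Y \<noteq> 0"
    using that by (auto simp: U_def norm_vector_scalar_mult vector_smult_assoc norm_divide)
  have Y0: "D x Y = of_real (norm Y) * D x U" if "Y \<noteq> 0"
    using scal[OF \<open>x \<in> ball x0 R\<close>, of "of_real (norm Y)" U] U[OF that] by simp
  have D0: "D x 0 = 0" using scal[OF \<open>x \<in> ball x0 R\<close>, of 0 0] by simp
  show "norm (D x Y) \<le> 4 * B / R * norm Y"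
  proof (cases "Y = 0")
    case False
    have "norm Y * norm (D x U) \<le> norm Y * (4 * B / R)"
      using main[OF U(1)[OF False]] by (intro mult_left_mono) auto
    then show ?thesis
      using Y0[OF False] by (simp add: norm_mult mult.commute)
  qed (use D0 in simp)
  show "norm (f (x + Y) - f x - D x Y) \<le> 72 * B / R^2 * norm Y ^ 2" if "norm Y \<le> R/4"
  proof (cases "Y = 0")
    case False
    show ?thesis
      using main[OF U(1)[OF False], of "of_real (norm Y)"] that U(2)[OF False] Y0[OF False] by simp
  qed (use D0 in simp)
qed

lemma has_field_derivative_along_line:
  fixes f :: "complex^'n \<Rightarrow> complex"
  assumes f: "(f has_derivative D) (at (m + l *s k))" and scal: "\<And>c X. D (c *s X) = c * D X"
  shows "((\<lambda>l. f (m + l *s k)) has_field_derivative D k) (at l)"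
proof -
  have "((\<lambda>l. m + l *s k) has_derivative (\<lambda>l. l *s k)) (at l)"
    by (auto intro!: derivative_eq_intros bounded_linear_imp_has_derivative
          bounded_linear_vector_scalar_mult_left)
  from has_derivative_compose[OF this, of f D] f
  have "((\<lambda>l. f (m + l *s k)) has_derivative (\<lambda>l. D (l *s k))) (at l)"
    by simp
  moreover have "(\<lambda>l. D (l *s k)) = (*) (D k)"
    using scal by (simp add: fun_eq_iff mult.commute)
  ultimately show ?thesis
    by (simp add: has_field_derivative_def)
qed

text \<open>Along a line in direction \<open>Y\<close>, the difference quotients of \<open>f\<close>
  in direction \<open>X\<close> converge locally uniformly to the derivative in direction
  \<open>X\<close>. By Weierstrass the limit is holomorphic on that line and derivatives pass to the
  limit, which gives the mixed second derivative together with its symmetry.\<close>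

lemma scalar_derivative_regular:
  fixes f :: "complex^'n \<Rightarrow> complex"
  assumes S: "open S"
    and f: "\<And>x. x \<in> S \<Longrightarrow> (f has_derivative D x) (at x)"
    and scal: "\<And>x c Y. x \<in> S \<Longrightarrow> D x (c *s Y) = c * D x Y"
  obtains H where
    "\<And>x X. x \<in> S \<Longrightarrow> ((\<lambda>x. D x X) has_derivative H x X) (at x)"
    "\<And>x X Y. x \<in> S \<Longrightarrow> H x X Y = H x Y X"
    "\<And>x X c Y. x \<in> S \<Longrightarrow> H x X (c *s Y) = c * H x X Y"
proof -
  have line: "((\<lambda>l. f (x + l *s Y)) has_field_derivative D x Y) (at 0)" if "x \<in> S" for x Y
    using has_field_derivative_along_line[where m = x and l = 0 and k = Y and D = "D x"] f scal that by simp
  have bdd: "\<exists>R B. R > 0 \<and> ball x R \<subseteq> S \<and> (\<forall>y\<in>ball x R. norm (f y) \<le> B)" if x: "x \<in> S" for x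
  proof -
    obtain R where R: "R > 0" "cball x R \<subseteq> S"
      using open_contains_cball_eq[OF S] x by blast
    have "continuous_on (cball x R) f"
    proof (intro continuous_at_imp_continuous_on ballI)
      fix y assume "y \<in> cball x R"
      then show "isCont f y"
        using f[of y] R has_derivative_continuous by blast
    qed
    then have "bounded (f ` cball x R)"
      by (intro compact_imp_bounded compact_continuous_image compact_cball)
    then obtain B where "\<forall>y\<in>cball x R. norm (f y) \<le> B"
      by (auto simp: bounded_iff)
    then show ?thesis using R by (intro exI[of _ R] exI[of _ B]) auto
  qed
  \<comment> \<open>The same number \<open>H\<close> is the derivative along \<open>Y\<close> of
    \<open>D\<close> in direction \<open>X\<close> and a limit of quotients along \<open>X\<close>
    of \<open>D\<close> in direction \<open>Y\<close>. A single sequence \<open>h\<close> suffices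
    for the second limit.\<close>
  have mixed: "\<exists>H h. ((\<lambda>l. D (x + l *s Y) X) has_field_derivative H) (at 0) \<and>
      (\<forall>n. h n \<noteq> 0) \<and> h \<longlonglongrightarrow> 0 \<and> (\<lambda>n. (D (x + h n *s X) Y - D x Y) / h n) \<longlonglongrightarrow> H"
    if x: "x \<in> S" for x X Y
  proof -
    obtain R B where R: "R > 0" "ball x R \<subseteq> S" and B: "\<And>y. y \<in> ball x R \<Longrightarrow> norm (f y) \<le> B"
      using bdd[OF x] by blast
    \<comment> \<open>Small enough for both increments to have norm at most \<open>R/4\<close>, so
      that a step in each direction stays inside the ball.\<close>
    define \<epsilon> where "\<epsilon> = R / (4 * (1 + norm X + norm Y))"
    have pos: "1 + norm X + norm Y > 0" by (smt (verit) norm_ge_zero)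
    have \<epsilon>: "\<epsilon> > 0" using R pos by (simp add: \<epsilon>_def)
    have "\<epsilon> * (1 + norm X + norm Y) = R / 4"
      using pos unfolding \<epsilon>_def by (metis times_divide_eq_left nonzero_mult_divide_mult_cancel_right less_irrefl)
    moreover have "\<epsilon> * norm X \<le> \<epsilon> * (1 + norm X + norm Y)" "\<epsilon> * norm Y \<le> \<epsilon> * (1 + norm X + norm Y)"
      using \<epsilon> by (auto intro!: mult_left_mono)
    ultimately have \<epsilon>XY: "\<epsilon> * norm X \<le> R / 4" "\<epsilon> * norm Y \<le> R / 4" by auto
    define h where "h n = (of_real (\<epsilon> / real (Suc n)) :: complex)" for n
    have h: "h n \<noteq> 0" "norm (h n) \<le> \<epsilon>" for n
      using \<epsilon> by (auto simp: h_def norm_divide field_simps simp del: of_nat_Suc)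
    have "(\<lambda>n. \<epsilon> / real (Suc n)) \<longlonglongrightarrow> 0"
      using LIMSEQ_Suc lim_const_over_n by blast
    then have h0: "h \<longlonglongrightarrow> 0"
      unfolding h_def by (metis tendsto_of_real_iff of_real_0)
    have small: "norm (l *s Y) \<le> R/4" "norm (m *s X) \<le> R/4" if "norm l \<le> \<epsilon>" "norm m \<le> \<epsilon>" for l m
    proof -
      have "norm l * norm Y \<le> \<epsilon> * norm Y" "norm m * norm X \<le> \<epsilon> * norm X"
        using that by (simp_all add: mult_right_mono)
      then show "norm (l *s Y) \<le> R/4" "norm (m *s X) \<le> R/4"
        using \<epsilon>XY by (simp_all add: norm_vector_scalar_mult)
    qed
    have inb: "x + l *s Y \<in> ball x (R/2)" "x + l *s Y + h n *s X \<in> ball x R"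
      if "l \<in> ball 0 \<epsilon>" for l n
    proof -
      have "norm (l *s Y) \<le> R/4" "norm (h n *s X) \<le> R/4"
        using small[of l "h n"] h(2)[of n] that by auto
      moreover have "norm (l *s Y + h n *s X) \<le> norm (l *s Y) + norm (h n *s X)"
        by (rule norm_triangle_ineq)
      moreover have dist_x: "dist x (x + v) = norm v" for v
        by (simp add: dist_norm)
      ultimately show "x + l *s Y \<in> ball x (R/2)" "x + l *s Y + h n *s X \<in> ball x R"
        using R dist_x[of "l *s Y"] dist_x[of "l *s Y + h n *s X"]
        unfolding mem_ball add.assoc by linarith+
    qed
    have inR: "x + l *s Y \<in> ball x R" if "l \<in> ball 0 \<epsilon>" for l
      using inb(1)[OF that] R by auto
    define q where "q n l = (f (x + l *s Y + h n *s X) - f (x + l *s Y)) / h n" for n l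
    define q' where "q' n l = (D (x + l *s Y + h n *s X) Y - D (x + l *s Y) Y) / h n" for n l
    have "\<exists>g'. \<forall>l\<in>ball 0 \<epsilon>. ((\<lambda>l. D (x + l *s Y) X) has_field_derivative g' l) (at l) \<and>
        (\<lambda>n. q' n l) \<longlonglongrightarrow> g' l"
    proof (rule has_complex_derivative_uniform_sequence[where f = q])
      fix n and l :: complex assume l: "l \<in> ball 0 \<epsilon>"
      have "((\<lambda>l. f (x + l *s Y)) has_field_derivative D (x + l *s Y) Y) (at l)"
        by (rule line_holomorphic[where S = S]) (use line inR[OF l] R in auto)
      moreover have "((\<lambda>l. f ((x + h n *s X) + l *s Y)) has_field_derivative D (x + h n *s X + l *s Y) Y) (at l)"
        by (rule line_holomorphic[where S = S]) (use line inb(2)[OF l, of n] R in \<open>auto simp: add_ac\<close>)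
      ultimately have "((\<lambda>l. (f ((x + h n *s X) + l *s Y) - f (x + l *s Y)) / h n) has_field_derivative
          (D (x + h n *s X + l *s Y) Y - D (x + l *s Y) Y) / h n) (at l)"
        by (intro DERIV_cdivide DERIV_diff)
      moreover have "x + h n *s X + l *s Y = x + l *s Y + h n *s X" for l
        by (simp add: add_ac)
      ultimately show "(q n has_field_derivative q' n l) (at l)"
        unfolding q_def q'_def by simp
    next
      fix l :: complex assume l: "l \<in> ball 0 \<epsilon>"
      obtain d where d: "d > 0" "cball l d \<subseteq> ball 0 \<epsilon>"
        using open_contains_cball_eq[OF open_ball] l by (metis)
      define C where "C = 72 * B / R^2 * norm X ^ 2"
      \<comment> \<open>The quadratic Taylor bound makes the error of the quotient linear in
        \<open>h n\<close>, uniformly in \<open>m\<close>.\<close>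
      have est: "norm (q n m - D (x + m *s Y) X) \<le> C * norm (h n)" if m: "m \<in> ball 0 \<epsilon>" for n m
      proof -
        have "norm (f (x + m *s Y + h n *s X) - f (x + m *s Y) - D (x + m *s Y) (h n *s X))
             \<le> 72 * B / R^2 * norm (h n *s X) ^ 2"
          by (rule line_holomorphic_bounds(1)[where D = D])
             (use line R B scal inb(1)[OF m] small[of 0 "h n"] h(2)[of n] \<epsilon> in \<open>auto\<close>)
        also have "\<dots> = (C * norm (h n)) * norm (h n)"
          by (simp add: C_def norm_vector_scalar_mult power2_eq_square algebra_simps)
        finally have "norm (f (x + m *s Y + h n *s X) - f (x + m *s Y) - h n * D (x + m *s Y) X) / norm (h n)
            \<le> C * norm (h n)"
          using h(1)[of n] scal R inR[OF m] by (subst pos_divide_le_eq) auto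
        then show ?thesis
          using h(1)[of n] by (simp add: q_def norm_divide[symmetric] diff_divide_distrib)
      qed
      have "uniform_limit (cball l d) q (\<lambda>l. D (x + l *s Y) X) sequentially"
      proof (rule uniform_limitI)
        fix e :: real assume "e > 0"
        have "(\<lambda>n. C * norm (h n)) \<longlonglongrightarrow> C * norm (0::complex)"
          by (intro tendsto_intros h0)
        then have "eventually (\<lambda>n. C * norm (h n) < e) sequentially"
          using \<open>e > 0\<close> by (auto intro: order_tendstoD)
        then show "eventually (\<lambda>n. \<forall>m\<in>cball l d. dist (q n m) (D (x + m *s Y) X) < e) sequentially"
        proof eventually_elim
          case (elim n)
          have "norm (q n m - D (x + m *s Y) X) < e" if "m \<in> cball l d" for m
            using est[of m n] elim subsetD[OF d(2) that] by linarith
          then show ?case by (simp add: dist_norm)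
        qed
      qed
      then show "\<exists>d>0. cball l d \<subseteq> ball 0 \<epsilon> \<and> uniform_limit (cball l d) q (\<lambda>l. D (x + l *s Y) X) sequentially"
        using d by blast
    qed auto
    then obtain g' where "\<forall>l\<in>ball 0 \<epsilon>. ((\<lambda>l. D (x + l *s Y) X) has_field_derivative g' l) (at l) \<and>
        (\<lambda>n. q' n l) \<longlonglongrightarrow> g' l" ..
    then have "((\<lambda>l. D (x + l *s Y) X) has_field_derivative g' 0) (at 0)" "(\<lambda>n. q' n 0) \<longlonglongrightarrow> g' 0"
      using \<epsilon> by simp_all
    then show ?thesis
      using h h0 by (intro exI[of _ "g' 0"] exI[of _ h]) (simp add: q'_def)
  qed
  define H where "H x X Y = deriv (\<lambda>l. D (x + l *s Y) X) 0" for x X Y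
  have H: "((\<lambda>l. D (x + l *s Y) X) has_field_derivative H x X Y) (at 0)" if "x \<in> S" for x X Y
  proof -
    obtain H' where "((\<lambda>l. D (x + l *s Y) X) has_field_derivative H') (at 0)"
      using mixed[OF \<open>x \<in> S\<close>, of Y X] by blast
    then show ?thesis
      unfolding H_def using DERIV_imp_deriv by blast
  qed
  have Hsym: "H x X Y = H x Y X" if x: "x \<in> S" for x X Y
  proof -
    obtain H' h where H': "((\<lambda>l. D (x + l *s Y) X) has_field_derivative H') (at 0)"
      and h: "\<forall>n. h n \<noteq> 0" "h \<longlonglongrightarrow> 0" "(\<lambda>n. (D (x + h n *s X) Y - D x Y) / h n) \<longlonglongrightarrow> H'"
      using mixed[OF x, of Y X] by blast
    have "H' = H x X Y"
      using DERIV_unique[OF H' H[OF x]] .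
    have "((\<lambda>k. (D (x + k *s X) Y - D x Y) / k) \<longlongrightarrow> H x Y X) (at 0)"
      using H[OF x, where X = Y and Y = X] by (simp add: DERIV_def)
    moreover have "filterlim h (at 0) sequentially"
      using h by (simp add: filterlim_at)
    ultimately have "(\<lambda>n. (D (x + h n *s X) Y - D x Y) / h n) \<longlonglongrightarrow> H x Y X"
      by (rule filterlim_compose)
    with h(3) have "H' = H x Y X"
      by (rule LIMSEQ_unique)
    with \<open>H' = H x X Y\<close> show ?thesis by simp
  qed
  \<comment> \<open>\<open>D\<close> is homogeneous in its vector, hence \<open>H\<close> in its
    first one; symmetry carries this over to the second, in which the total derivative has to be
    linear. Additivity is obtained in the same way.\<close>
  have Hscal: "H x X (c *s Y) = c * H x X Y" if x: "x \<in> S" for x X Y c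
  proof -
    have "\<forall>\<^sub>F l in nhds 0. x + l *s X \<in> S"
    proof -
      have "open ((\<lambda>l. x + l *s X) -` S)"
        by (intro open_vimage S continuous_intros)
      then show ?thesis using x by (auto simp: eventually_nhds intro!: exI[of _ "(\<lambda>l. x + l *s X) -` S"])
    qed
    then have ev: "\<forall>\<^sub>F l in nhds 0. c * D (x + l *s X) Y = D (x + l *s X) (c *s Y)"
      by eventually_elim (simp add: scal)
    have "((\<lambda>l. c * D (x + l *s X) Y) has_field_derivative c * H x Y X) (at 0)"
      using H[OF x, where X = Y and Y = X] by (rule DERIV_cmult)
    then have "((\<lambda>l. D (x + l *s X) (c *s Y)) has_field_derivative c * H x Y X) (at 0)"
      by (simp only: DERIV_cong_ev[OF refl ev refl])
    then have "H x (c *s Y) X = c * H x Y X"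
      using H[OF x, where X = "c *s Y" and Y = X] DERIV_unique by blast
    then show ?thesis using Hsym[OF x] by metis
  qed
  have Hadd: "H x X (Y + Z) = H x X Y + H x X Z" if x: "x \<in> S" for x X Y Z
  proof -
    have "\<forall>\<^sub>F l in nhds 0. x + l *s X \<in> S"
    proof -
      have "open ((\<lambda>l. x + l *s X) -` S)"
        by (intro open_vimage S continuous_intros)
      then show ?thesis using x by (auto simp: eventually_nhds intro!: exI[of _ "(\<lambda>l. x + l *s X) -` S"])
    qed
    then have ev: "\<forall>\<^sub>F l in nhds 0. D (x + l *s X) Y + D (x + l *s X) Z = D (x + l *s X) (Y + Z)"
      by eventually_elim (simp add: linear_add[OF has_derivative_linear[OF f]])
    have "((\<lambda>l. D (x + l *s X) Y + D (x + l *s X) Z) has_field_derivative H x Y X + H x Z X) (at 0)"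
      using H[OF x, where X = Y and Y = X] H[OF x, where X = Z and Y = X] by (rule DERIV_add)
    then have "((\<lambda>l. D (x + l *s X) (Y + Z)) has_field_derivative H x Y X + H x Z X) (at 0)"
      by (simp only: DERIV_cong_ev[OF refl ev refl])
    then have "H x (Y + Z) X = H x Y X + H x Z X"
      using H[OF x, where X = "Y + Z" and Y = X] DERIV_unique by blast
    then show ?thesis using Hsym[OF x] by metis
  qed
  \<comment> \<open>The line estimates are used twice: first to bound \<open>D y X\<close> near
    \<open>x\<close>, then, with this bound, to make the remainder of \<open>D y X\<close> quadratic
    in the increment.\<close>
  have Hder: "((\<lambda>x. D x X) has_derivative H x X) (at x)" if x: "x \<in> S" for x X
  proof -
    obtain R B where R: "R > 0" "ball x R \<subseteq> S" and B: "\<And>y. y \<in> ball x R \<Longrightarrow> norm (f y) \<le> B"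
      using bdd[OF x] by blast
    define R' where "R' = R/2"
    define B' where "B' = 4 * B / R * norm X"
    have R': "R' > 0" "ball x R' \<subseteq> ball x R" using R by (auto simp: R'_def)
    have sub: "y \<in> S" if "y \<in> ball x R'" for y
      using that R R' by blast
    have DB: "norm (D y X) \<le> B'" if "y \<in> ball x R'" for y
      unfolding B'_def
      by (rule line_holomorphic_bounds(2)[where f = f and ?x0.0 = x])
         (use that line R B scal in \<open>auto simp: R'_def\<close>)
    have est: "norm (D (x + Y) X - D x X - H x X Y) \<le> 72 * B' / R'^2 * norm Y ^ 2" if "norm Y \<le> R'/4" for Y
      by (rule line_holomorphic_bounds(1)[where f = "\<lambda>y. D y X" and D = "\<lambda>y. H y X" and ?x0.0 = x])
         (use that H R' DB Hscal sub in \<open>auto simp del: mem_ball\<close>)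
    define K where "K = 72 * B' / R'^2"
    have "bounded_linear (H x X)"
      unfolding linear_conv_bounded_linear[symmetric]
      using Hadd[OF x] Hscal[OF x]
      by (intro linearI) (auto simp: scaleR_eq_vector_scalar_mult scaleR_conv_of_real)
    then show ?thesis
    proof (rule has_derivativeI_sandwich[rotated])
      have "((\<lambda>y. K * norm (y - x)) \<longlongrightarrow> K * norm (x - x)) (at x)"
        by (intro tendsto_intros)
      then show "((\<lambda>y. K * norm (y - x)) \<longlongrightarrow> 0) (at x)"
        by simp
      show "norm (D y X - D x X - H x X (y - x)) / norm (y - x) \<le> K * norm (y - x)"
        if "y \<noteq> x" "dist y x < R'/4" for y
      proof -
        have "norm (D y X - D x X - H x X (y - x)) \<le> K * norm (y - x) ^ 2"
          using est[of "y - x"] that(2) by (simp add: dist_norm K_def)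
        then show ?thesis
          using that(1) by (subst pos_divide_le_eq) (simp_all add: power2_eq_square mult.assoc)
      qed
    qed (use R' in auto)
  qed
  show ?thesis
    by (rule that[of H]) (use Hder Hsym Hscal in auto)
qed

section \<open>Jacobian matrices of holomorphic maps\<close>

lemma has_derivative_vecI:
  fixes f :: "'a::real_normed_vector \<Rightarrow> 'b::euclidean_space^'n"
  assumes "\<And>i. ((\<lambda>x. f x $ i) has_derivative (\<lambda>h. f' h $ i)) (at a within S)"
  shows "(f has_derivative f') (at a within S)"
  unfolding has_derivative_componentwise_within[of f]
proof
  fix b :: "'b^'n" assume "b \<in> Basis"
  then obtain i c where b: "b = axis i c" "c \<in> Basis"
    by (auto simp: Basis_vec_def)
  show "((\<lambda>x. f x \<bullet> b) has_derivative (\<lambda>x. f' x \<bullet> b)) (at a within S)"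
    unfolding b inner_axis by (intro has_derivative_inner_left assms)
qed

text \<open>The scalar result is applied to every component of \<open>g\<close>, and
  \<open>Q x X\<close> collects the derivatives of the Jacobian in direction \<open>X\<close>.
  Equality of mixed derivatives appears as a symmetry between \<open>X\<close> and \<open>Y\<close>,
  the form in which \<open>Q\<close> serves as second fundamental form.\<close>

lemma jacobian_regular:
  fixes g :: "complex^'n \<Rightarrow> complex^'k" and G :: "complex^'n \<Rightarrow> complex^'n^'k"
  assumes S: "open S" and g: "\<And>x. x \<in> S \<Longrightarrow> (g has_derivative (*v) (G x)) (at x)"
  obtains Q :: "complex^'n \<Rightarrow> complex^'n \<Rightarrow> complex^'n^'k" where
    "\<And>x i j. x \<in> S \<Longrightarrow> ((\<lambda>x. G x $ i $ j) has_derivative (\<lambda>X. Q x X $ i $ j)) (at x)"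
    "\<And>x c X. x \<in> S \<Longrightarrow> Q x (c *s X) = (\<chi> i j. c * Q x X $ i $ j)"
    "\<And>x X Y. x \<in> S \<Longrightarrow> Q x X *v Y = Q x Y *v X"
proof -
  have "\<exists>H. (\<forall>x\<in>S. \<forall>X. ((\<lambda>x. (G x *v X) $ i) has_derivative H x X) (at x)) \<and>
      (\<forall>x\<in>S. \<forall>X Y. H x X Y = H x Y X) \<and>
      (\<forall>x\<in>S. \<forall>X c Y. H x X (c *s Y) = c * H x X Y)" for i
  proof -
    have der: "((\<lambda>x. g x $ i) has_derivative (\<lambda>X. (G x *v X) $ i)) (at x)" if "x \<in> S" for x
      using bounded_linear.has_derivative[OF bounded_linear_vec_nth g[OF that]] .
    have scal: "(G x *v (c *s Y)) $ i = c * (G x *v Y) $ i" for x c Y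
      by (simp add: vector_scalar_commute)
    obtain H where "\<And>x X. x \<in> S \<Longrightarrow> ((\<lambda>x. (G x *v X) $ i) has_derivative H x X) (at x)"
      "\<And>x X Y. x \<in> S \<Longrightarrow> H x X Y = H x Y X"
      "\<And>x X c Y. x \<in> S \<Longrightarrow> H x X (c *s Y) = c * H x X Y"
      using scalar_derivative_regular[where D = "\<lambda>x X. (G x *v X) $ i", OF S der scal] by blast
    then show ?thesis by (intro exI[of _ H]) simp
  qed
  then obtain H where Hder: "\<And>i x X. x \<in> S \<Longrightarrow> ((\<lambda>x. (G x *v X) $ i) has_derivative H i x X) (at x)"
    and Hsym: "\<And>i x X Y. x \<in> S \<Longrightarrow> H i x X Y = H i x Y X"
    and Hscal: "\<And>i x X c Y. x \<in> S \<Longrightarrow> H i x X (c *s Y) = c * H i x X Y"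
    by metis
  define Q where "Q x X = (\<chi> i j. H i x (axis j 1) X)" for x X
  \<comment> \<open>\<open>Q\<close> records \<open>H\<close> only on basis vectors in its first
    slot; symmetry moves \<open>Z\<close> into the slot where \<open>H\<close> is known to be
    complex linear.\<close>
  have QH: "(Q x X *v Z) $ i = H i x Z X" if x: "x \<in> S" for x X Z i
  proof -
    have lin: "linear (H i x X)"
      using Hder[OF x] has_derivative_linear by blast
    have "H i x X Z = H i x X (\<Sum>j\<in>UNIV. Z $ j *s axis j 1)"
      by (simp add: basis_expansion)
    also have "\<dots> = (\<Sum>j\<in>UNIV. Z $ j * H i x X (axis j 1))"
      by (simp add: linear_sum[OF lin] Hscal[OF x])
    also have "\<dots> = (Q x X *v Z) $ i"
      by (simp add: Q_def matrix_vector_mult_def Hsym[OF x, of i X] mult.commute)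
    finally show ?thesis
      using Hsym[OF x, of i Z X] by simp
  qed
  show ?thesis
  proof (rule that[of Q])
    fix x :: "complex^'n" assume x: "x \<in> S"
    show "((\<lambda>x. G x $ i $ j) has_derivative (\<lambda>X. Q x X $ i $ j)) (at x)" for i j
    proof -
      have "(G y *v axis j 1) $ i = G y $ i $ j" for y
        by (simp add: matrix_vector_mult_def axis_def if_distrib cong: if_cong)
      then show ?thesis
        using Hder[OF x, of "axis j 1" i] by (simp add: Q_def)
    qed
    show "Q x (c *s X) = (\<chi> i j. c * Q x X $ i $ j)" for c X
      by (simp add: Q_def Hscal[OF x])
    show "Q x X *v Y = Q x Y *v X" for X Y
      using QH[OF x] Hsym[OF x] by (simp add: vec_eq_iff)
  qed
qed

lemma holomorphic_map_onE:
  fixes g :: "complex^'n \<Rightarrow> complex^'k"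
  assumes "holomorphic_map_on g S" "open S"
  obtains G where "\<And>x. x \<in> S \<Longrightarrow> (g has_derivative (*v) (G x)) (at x)"
proof (rule that)
  fix x assume x: "x \<in> S"
  obtain D where D: "Vector_Spaces.linear (*s) (*s) D" "(g has_derivative D) (at x)"
    using assms x unfolding holomorphic_map_on_def by (metis at_within_open)
  then have "D = (*v) (matrix (frechet_derivative g (at x)))"
    using matrix_works frechet_derivative_at by (metis ext)
  with D show "(g has_derivative (*v) (matrix (frechet_derivative g (at x)))) (at x)"
    by simp
qed

lemma holomorphic_map_onI:
  fixes g :: "complex^'n \<Rightarrow> complex^'k"
  assumes "\<And>x. x \<in> S \<Longrightarrow> (g has_derivative (*v) (G x)) (at x)"
  shows "holomorphic_map_on g S"
  unfolding holomorphic_map_on_def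
  using assms by (meson has_derivative_at_withinI matrix_vector_mul_linear_gen)

lemma holomorphic_along_line:
  fixes f :: "complex^'n \<Rightarrow> complex"
  assumes "\<And>x. x \<in> S \<Longrightarrow> (f has_derivative D x) (at x)"
    and "\<And>x c X. x \<in> S \<Longrightarrow> D x (c *s X) = c * D x X" and "open S"
  shows "(\<lambda>l. f (m + l *s k)) holomorphic_on {l. m + l *s k \<in> S}"
proof -
  have op: "open {l. m + l *s k \<in> S}"
  proof -
    have "open ((\<lambda>l. m + l *s k) -` S)"
      by (intro open_vimage assms continuous_intros)
    then show ?thesis by (simp add: vimage_def)
  qed
  have "((\<lambda>l. f (m + l *s k)) has_field_derivative D (m + l *s k) k) (at l)" if "m + l *s k \<in> S" for l
    using assms(1,2)[OF that] by (intro has_field_derivative_along_line)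
  then show ?thesis
    unfolding holomorphic_on_open[OF op] by blast
qed

section \<open>The Hermitian inner product\<close>

definition cinner :: "complex^'n \<Rightarrow> complex^'n \<Rightarrow> complex"
  where "cinner x y = (\<Sum>i\<in>UNIV. x $ i * cnj (y $ i))"

lemma cinner_add_left: "cinner (x + x') y = cinner x y + cinner x' y"
  and cinner_add_right: "cinner x (y + y') = cinner x y + cinner x y'"
  and cinner_diff_left: "cinner (x - x') y = cinner x y - cinner x' y"
  and cinner_diff_right: "cinner x (y - y') = cinner x y - cinner x y'"
  and cinner_scale_left: "cinner (c *s x) y = c * cinner x y"
  and cinner_scale_right: "cinner x (c *s y) = cnj c * cinner x y"
  and cinner_zero_left [simp]: "cinner 0 y = 0"
  and cinner_zero_right [simp]: "cinner x 0 = 0"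
  by (simp_all add: cinner_def algebra_simps sum.distrib sum_subtractf sum_distrib_left)

lemmas cinner_simps = cinner_add_left cinner_add_right cinner_diff_left cinner_diff_right
  cinner_scale_left cinner_scale_right

lemma cinner_commute: "cinner y x = cnj (cinner x y)"
  by (simp add: cinner_def mult.commute)

lemma cinner_eq_0_commute: "cinner y x = 0 \<longleftrightarrow> cinner x y = 0"
  by (subst cinner_commute) simp

lemma Re_cinner: "Re (cinner x y) = x \<bullet> y"
  by (simp add: cinner_def inner_vec_def inner_complex_def)

lemma cinner_self: "cinner x x = of_real ((norm x)\<^sup>2)"
proof (rule complex_eqI)
  show "Re (cinner x x) = Re (of_real ((norm x)\<^sup>2))"
    by (simp only: Re_cinner power2_norm_eq_inner Re_complex_of_real)
  have "Im (cinner x x) = - Im (cinner x x)"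
    by (subst cinner_commute) simp
  then show "Im (cinner x x) = Im (of_real ((norm x)\<^sup>2))"
    by simp
qed

lemma cinner_self_eq_0 [simp]: "cinner x x = 0 \<longleftrightarrow> x = 0"
  unfolding cinner_self by simp

lemma cinner_eq_inner: "cinner x y = Complex (x \<bullet> y) (x \<bullet> (\<i> *s y))"
proof (rule complex_eqI)
  have "x \<bullet> (\<i> *s y) = Re (cinner x (\<i> *s y))" by (simp add: Re_cinner)
  also have "\<dots> = Im (cinner x y)" by (simp add: cinner_scale_right)
  finally show "Im (cinner x y) = Im (Complex (x \<bullet> y) (x \<bullet> (\<i> *s y)))" by simp
qed (simp add: Re_cinner)

lemma cinner_adjoint: "cinner (A *v x) y = cinner x (conjugate_transpose A *v y)"
proof -
  have "cinner (A *v x) y = (\<Sum>i\<in>UNIV. \<Sum>j\<in>UNIV. A $ i $ j * x $ j * cnj (y $ i))"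
    by (simp add: cinner_def matrix_vector_mult_def sum_distrib_right)
  also have "\<dots> = (\<Sum>j\<in>UNIV. \<Sum>i\<in>UNIV. A $ i $ j * x $ j * cnj (y $ i))"
    by (rule sum.swap)
  also have "\<dots> = cinner x (conjugate_transpose A *v y)"
    by (simp add: cinner_def matrix_vector_mult_def sum_distrib_left conjugate_transpose_def mult_ac)
  finally show ?thesis .
qed

lemma bounded_bilinear_cinner: "bounded_bilinear cinner"
proof
  show "\<exists>K. \<forall>a b :: complex^'n. norm (cinner a b) \<le> norm a * norm b * K"
  proof (intro exI[of _ "real CARD('n)"] allI)
    fix a b :: "complex^'n"
    have "norm (cinner a b) \<le> (\<Sum>i\<in>UNIV. norm (a $ i * cnj (b $ i)))"
      unfolding cinner_def by (rule norm_sum)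
    also have "\<dots> \<le> (\<Sum>i\<in>(UNIV::'n set). norm a * norm b)"
      by (intro sum_mono) (simp add: norm_mult mult_mono component_le_norm_cart Finite_Cartesian_Product.norm_nth_le)
    finally show "norm (cinner a b) \<le> norm a * norm b * real CARD('n)"
      by (simp add: mult.commute)
  qed
qed (simp_all add: cinner_simps scaleR_eq_vector_scalar_mult scaleR_conv_of_real)

lemmas tendsto_cinner = bounded_bilinear.tendsto[OF bounded_bilinear_cinner]

lemma eq_if_cinner_eq:
  assumes "\<And>z. cinner z x = cinner z y"
  shows "x = y"
proof -
  have "cinner (x - y) (x - y) = 0"
    using assms[of "x - y"] by (simp add: cinner_diff_right)
  then show ?thesis by simp
qed

section \<open>Polarization\<close>

text \<open>On the pairs \<open>m + l *s k\<close>, \<open>m + cnj l *s k\<close> the two points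
  coincide for real \<open>l\<close>, so the function of \<open>l\<close> vanishes on a real
  interval, and the identity theorem extends this to all admissible \<open>l\<close>. The model case
  is a \<open>\<Phi>\<close> holomorphic in its first variable and antiholomorphic in its second,
  which is why the second point carries \<open>cnj l\<close>.\<close>

lemma polarization:
  fixes \<Phi> :: "complex^'n \<Rightarrow> complex^'n \<Rightarrow> complex"
  assumes hol: "\<And>m k. (\<lambda>l. \<Phi> (m + l *s k) (m + cnj l *s k)) holomorphic_on
      {l. m + l *s k \<in> ball 0 \<rho> \<and> m + cnj l *s k \<in> ball 0 \<rho>}"
    and diag: "\<And>x. x \<in> ball 0 \<rho> \<Longrightarrow> \<Phi> x x = 0"
    and x: "x \<in> ball 0 \<rho>" and y: "y \<in> ball 0 \<rho>"
  shows "\<Phi> x y = 0"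
proof -
  \<comment> \<open>Chosen so that \<open>l = \<i>\<close> gives \<open>x\<close> in the first slot
    and, since its conjugate is \<open>- \<i>\<close>, \<open>y\<close> in the second.\<close>
  define m where "m = (1/2) *s (x + y)"
  define k where "k = (1/(2*\<i>)) *s (x - y)"
  have mk: "m + \<i> *s k = x" "m + (-\<i>) *s k = y"
    by (simp_all add: m_def k_def vec_eq_iff field_simps)
  define S where "S = {l. m + l *s k \<in> ball 0 \<rho> \<and> m + cnj l *s k \<in> ball 0 \<rho>}"
  \<comment> \<open>Convexity provides the connectedness for the identity theorem and places 0, the
    midpoint of \<open>\<i>\<close> and \<open>- \<i>\<close>, in the domain.\<close>
  have conv: "convex S"
  proof (rule convexI)
    fix a b :: complex and u v :: real
    assume a: "a \<in> S" and b: "b \<in> S" and uv: "u \<ge> 0" "v \<ge> 0" "u + v = 1"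
    have eq: "m + (u *\<^sub>R a + v *\<^sub>R b) *s k = u *\<^sub>R (m + a *s k) + v *\<^sub>R (m + b *s k)" for a b
    proof -
      have "m = u *\<^sub>R m + v *\<^sub>R m"
        using uv by (simp flip: scaleR_add_left)
      then show ?thesis
        by (simp add: scaleR_eq_vector_scalar_mult vec_eq_iff algebra_simps scaleR_conv_of_real)
    qed
    show "u *\<^sub>R a + v *\<^sub>R b \<in> S"
      using a b uv convexD[OF convex_ball[of 0 \<rho>], of "m + a *s k" "m + b *s k" u v]
        convexD[OF convex_ball[of 0 \<rho>], of "m + cnj a *s k" "m + cnj b *s k" u v]
        eq[of a b] eq[of "cnj a" "cnj b"]
      by (simp add: S_def)
  qed
  have op: "open S"
  proof -
    have "open ((\<lambda>l. m + l *s k) -` ball 0 \<rho> \<inter> (\<lambda>l. m + cnj l *s k) -` ball 0 \<rho>)"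
      by (intro open_Int open_vimage open_ball continuous_intros)
    then show ?thesis by (simp add: S_def vimage_def Collect_conj_eq)
  qed
  have "\<i> \<in> S" "-\<i> \<in> S"
    using x y mk by (simp_all add: S_def)
  then have "0 \<in> S"
    using convexD[OF conv, of \<i> "-\<i>" "1/2" "1/2"] by simp
  have "\<Phi> (m + \<i> *s k) (m + cnj \<i> *s k) = 0"
  proof (rule analytic_continuation[where f = "\<lambda>l. \<Phi> (m + l *s k) (m + cnj l *s k)" and S = S and U = "S \<inter> \<real>" and \<xi> = 0])
    show "0 islimpt S \<inter> \<real>"
      unfolding islimpt_approachable
    proof (intro allI impI)
      fix e :: real assume "e > 0"
      obtain d where d: "d > 0" "ball 0 d \<subseteq> S"
        using op \<open>0 \<in> S\<close> open_contains_ball_eq by metis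
      define t where "t = min e d / 2"
      have "t > 0" "t < e" "t < d" using \<open>e > 0\<close> d by (auto simp: t_def)
      then have "of_real t \<in> S \<inter> \<real>" "of_real t \<noteq> (0::complex)" "dist (of_real t) (0::complex) < e"
        using d by (auto simp: subset_iff)
      then show "\<exists>x'\<in>S \<inter> \<real>. x' \<noteq> 0 \<and> dist x' 0 < e" by blast
    qed
    show "\<Phi> (m + z *s k) (m + cnj z *s k) = 0" if "z \<in> S \<inter> \<real>" for z
      using that diag[of "m + z *s k"] by (auto simp: S_def Reals_cnj_iff)
  qed (use hol[of m k] op convex_connected[OF conv] \<open>0 \<in> S\<close> \<open>\<i> \<in> S\<close> in \<open>auto simp: S_def\<close>)
  then show ?thesis using mk by simp
qed

section \<open>Polarizing the helix condition\<close>

lemma holomorphic_on_det: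
  assumes "\<And>i j. (\<lambda>l. A l $ i $ j) holomorphic_on S"
  shows "(\<lambda>l. det (A l :: complex^'n^'n)) holomorphic_on S"
  unfolding det_def by (intro holomorphic_intros assms)

lemma tendsto_det:
  assumes "\<And>i j. ((\<lambda>l. A l $ i $ j) \<longlongrightarrow> B $ i $ j) F"
  shows "((\<lambda>l. det (A l :: complex^'n^'n)) \<longlongrightarrow> det B) F"
  unfolding det_def by (intro tendsto_intros assms)

lemma holomorphic_on_cnj_cnj:
  assumes "f holomorphic_on T" and "\<And>l. l \<in> S \<Longrightarrow> cnj l \<in> T" and "open S" "open T"
  shows "(\<lambda>l. cnj (f (cnj l))) holomorphic_on S"
proof -
  have "f holomorphic_on cnj ` S"
    using assms(1,2) by (auto intro: holomorphic_on_subset)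
  from holomorphic_on_compose_cnj_cnj[OF this \<open>open S\<close>] show ?thesis
    by (simp add: o_def)
qed

text \<open>The equation for \<open>u\<close> is solved by Cramer's rule. Multiplied by the
  determinant, the helix condition becomes polynomial in the entries of \<open>G x\<close> and the
  conjugated entries of \<open>G y\<close>, to which polarization applies; the determinant is
  cancelled at the end.\<close>

lemma polarized_projection_identity:
  fixes G :: "complex^'n \<Rightarrow> complex^'n^'n" and b :: "complex^'n \<Rightarrow> complex^'n"
  assumes hol: "\<And>m k i j. (\<lambda>l. G (m + l *s k) $ i $ j) holomorphic_on {l. m + l *s k \<in> ball 0 \<rho>}"
    and b: "\<And>x. b x = \<tau> + conjugate_transpose (G x) *v \<xi>"
    and diag: "\<And>x. x \<in> ball 0 \<rho> \<Longrightarrow> \<exists>u. u + conjugate_transpose (G x) *v (G x *v u) = b x \<and> cinner u (b x) = \<kappa>"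
    and x: "x \<in> ball 0 \<rho>" and y: "y \<in> ball 0 \<rho>"
    and u: "u + conjugate_transpose (G y) *v (G x *v u) = b y"
    and inv: "det (mat 1 + conjugate_transpose (G y) ** G x) \<noteq> 0"
  shows "cinner u (b x) = \<kappa>"
proof -
  define M where "M x y = mat 1 + conjugate_transpose (G y) ** G x" for x y
  have M: "M x y *v u = u + conjugate_transpose (G y) *v (G x *v u)" for x y u
    by (simp add: M_def matrix_vector_mult_add_rdistrib matrix_vector_mul_assoc)
  have M_nth: "M x y $ i $ j = (if i = j then 1 else 0) + (\<Sum>l\<in>UNIV. cnj (G y $ l $ i) * G x $ l $ j)" for x y i j
    by (simp add: M_def mat_def matrix_matrix_mult_def conjugate_transpose_def)
  have b_nth: "b x $ k = \<tau> $ k + (\<Sum>l\<in>UNIV. cnj (G x $ l $ k) * \<xi> $ l)" for x k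
    by (simp add: b matrix_vector_mult_def conjugate_transpose_def)
  \<comment> \<open>The determinant times \<open>cinner u (b x) - \<kappa>\<close>, with
    \<open>u\<close> eliminated by Cramer's rule. Only \<open>b y\<close> enters the numerators and
    only the conjugate of \<open>b x\<close> the pairing, so \<open>\<Phi>\<close> is holomorphic in
    \<open>x\<close> and antiholomorphic in \<open>y\<close>.\<close>
  define \<Phi> where "\<Phi> x y = (\<Sum>k\<in>UNIV. det (\<chi> i j. if j = k then b y $ i else M x y $ i $ j) * cnj (b x $ k))
      - \<kappa> * det (M x y)" for x y
  have \<Phi>_eq: "\<Phi> x y = det (M x y) * (cinner u (b x) - \<kappa>)" if "M x y *v u = b y" for x y u
    using cramer_lemma[where A = "M x y" and x = u, unfolded that]
    by (simp add: \<Phi>_def cinner_def sum_distrib_left algebra_simps)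
  have "\<Phi> x y = 0"
  proof (rule polarization[OF _ _ x y])
    show "\<Phi> z z = 0" if z: "z \<in> ball 0 \<rho>" for z
    proof -
      obtain u where "M z z *v u = b z" "cinner u (b z) = \<kappa>"
        using diag[OF z] by (auto simp: M)
      then show ?thesis by (simp add: \<Phi>_eq)
    qed
  next
    fix m k :: "complex^'n"
    define S where "S = {l. m + l *s k \<in> ball 0 \<rho> \<and> m + cnj l *s k \<in> ball 0 \<rho>}"
    define T where "T = {l. m + l *s k \<in> ball 0 \<rho>}"
    have op: "open S" "open T"
    proof -
      have "open ((\<lambda>l. m + l *s k) -` ball 0 \<rho> \<inter> (\<lambda>l. m + cnj l *s k) -` ball 0 \<rho>)"
        "open ((\<lambda>l. m + l *s k) -` ball 0 \<rho>)"
        by (intro open_Int open_vimage open_ball continuous_intros)+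
      then show "open S" "open T" by (simp_all add: S_def T_def vimage_def Collect_conj_eq)
    qed
    have h1: "(\<lambda>l. G (m + l *s k) $ i $ j) holomorphic_on S" for i j
      using hol[of m k i j] by (rule holomorphic_on_subset) (auto simp: S_def)
    \<comment> \<open>Conjugating both the argument and the value restores holomorphy in
      \<open>l\<close>.\<close>
    have h2: "(\<lambda>l. cnj (G (m + cnj l *s k) $ i $ j)) holomorphic_on S" for i j
      by (rule holomorphic_on_cnj_cnj[where T = T and f = "\<lambda>l. G (m + l *s k) $ i $ j"])
         (use hol[of m k i j] op in \<open>auto simp: S_def T_def\<close>)
    have h3: "(\<lambda>l. b (m + cnj l *s k) $ i) holomorphic_on S" for i
      unfolding b_nth by (intro holomorphic_intros h2)
    have h4: "(\<lambda>l. cnj (b (m + l *s k) $ i)) holomorphic_on S" for i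
      unfolding b_nth cnj_sum complex_cnj_add complex_cnj_mult complex_cnj_cnj
      by (intro holomorphic_intros h1)
    have h5: "(\<lambda>l. M (m + l *s k) (m + cnj l *s k) $ i $ j) holomorphic_on S" for i j
      unfolding M_nth by (intro holomorphic_intros h1 h2)
    have h6: "(\<lambda>l. (\<chi> i j. if j = q then b (m + cnj l *s k) $ i
        else M (m + l *s k) (m + cnj l *s k) $ i $ j) $ i $ j) holomorphic_on S" for q i j
      by (cases "j = q") (simp_all add: h3 h5)
    show "(\<lambda>l. \<Phi> (m + l *s k) (m + cnj l *s k)) holomorphic_on
        {l. m + l *s k \<in> ball 0 \<rho> \<and> m + cnj l *s k \<in> ball 0 \<rho>}"
      unfolding \<Phi>_def S_def[symmetric]
      by (intro holomorphic_intros holomorphic_on_det h4 h5 h6)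
  qed
  moreover have "M x y *v u = b y" using u by (simp add: M)
  ultimately show ?thesis
    using inv \<Phi>_eq by (auto simp: M_def)
qed

text \<open>The polarized identity is expanded in \<open>x\<close> at 0 with \<open>y\<close> fixed.
  At \<open>x = 0\<close> the matrix \<open>G x\<close> vanishes, \<open>u\<close> is
  \<open>b y\<close> and \<open>b 0 = \<tau>\<close>, which is the second claim; the linear term
  along \<open>x = l *s X\<close> is the first.\<close>

lemma first_variation_polarized:
  fixes G :: "complex^'n \<Rightarrow> complex^'n^'n" and b :: "complex^'n \<Rightarrow> complex^'n"
  assumes hol: "\<And>m k i j. (\<lambda>l. G (m + l *s k) $ i $ j) holomorphic_on {l. m + l *s k \<in> ball 0 \<rho>}"
    and b: "\<And>x. b x = \<tau> + conjugate_transpose (G x) *v \<xi>"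
    and diag: "\<And>x. x \<in> ball 0 \<rho> \<Longrightarrow> \<exists>u. u + conjugate_transpose (G x) *v (G x *v u) = b x \<and> cinner u (b x) = \<kappa>"
    and Q: "\<And>X i j. ((\<lambda>l. G (l *s X) $ i $ j) has_field_derivative Q X $ i $ j) (at 0)"
    and G0: "G 0 = 0" and \<rho>: "\<rho> > 0" and y: "y \<in> ball 0 \<rho>"
  shows "cinner (Q X *v b y) (\<xi> - G y *v \<tau>) = 0" and "cinner (b y) \<tau> = \<kappa>"
proof -
  define M where "M l = mat 1 + conjugate_transpose (G y) ** G (l *s X)" for l
  have M_nth: "M l $ i $ j = (if i = j then 1 else 0) + (\<Sum>q\<in>UNIV. cnj (G y $ q $ i) * G (l *s X) $ q $ j)" for l i j
    by (simp add: M_def mat_def matrix_matrix_mult_def conjugate_transpose_def)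
  note ident = polarized_projection_identity[OF hol b diag]
  have b0: "b 0 = \<tau>"
    by (simp add: b G0 conjugate_transpose_def vec_eq_iff matrix_vector_mult_def)
  have "det (mat 1 :: complex^'n^'n) = 1" by simp
  then show by0: "cinner (b y) \<tau> = \<kappa>"
    using ident[of 0 y "b y"] \<rho> y b0 G0 by simp
  have G_lim: "((\<lambda>l. G (l *s X) $ i $ j) \<longlongrightarrow> 0) (at 0)" for i j
    using DERIV_isCont[OF Q[of X i j]] G0 by (simp add: isCont_def)
  have M_lim: "((\<lambda>l. M l $ i $ j) \<longlongrightarrow> (mat 1 :: complex^'n^'n) $ i $ j) (at 0)" for i j
    unfolding M_nth mat_def by (rule tendsto_eq_intros G_lim refl | simp)+
  have det_lim: "((\<lambda>l. det (M l)) \<longlongrightarrow> 1) (at 0)"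
    using tendsto_det[OF M_lim] by simp
  then have ev_det: "\<forall>\<^sub>F l in at 0. det (M l) \<noteq> 0"
    by (rule tendsto_imp_eventually_ne) simp
  \<comment> \<open>Cramer's solution of the polarized equation at \<open>x = l *s X\<close>. As
    \<open>l\<close> tends to 0 the matrix tends to the identity, so \<open>u l\<close> tends to
    \<open>b y\<close>.\<close>
  define u where "u l = (\<chi> k. det (\<chi> i j. if j = k then b y $ i else M l $ i $ j) / det (M l))" for l
  have u_lim: "(u \<longlongrightarrow> b y) (at 0)"
  proof (rule vec_tendstoI)
    fix k
    have "((\<lambda>l. (\<chi> i j. if j = k then b y $ i else M l $ i $ j) $ i $ j) \<longlongrightarrow>
        (\<chi> i j. if j = k then b y $ i else mat 1 $ i $ j) $ i $ j) (at 0)" for i j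
      using M_lim by (cases "j = k") simp_all
    then have "((\<lambda>l. u l $ k) \<longlongrightarrow> det (\<chi> i j. if j = k then b y $ i else mat 1 $ i $ j) / 1) (at 0)"
      unfolding u_def vec_lambda_beta by (intro tendsto_divide tendsto_det det_lim) simp_all
    then show "((\<lambda>l. u l $ k) \<longlongrightarrow> b y $ k) (at 0)"
      using cramer_lemma[where A = "mat 1" and x = "b y" and k = k, unfolded matrix_vector_mul_lid] by simp
  qed
  have ev_ball: "\<forall>\<^sub>F l in at 0. l *s X \<in> ball 0 \<rho>"
  proof -
    have "((\<lambda>l. l *s X) \<longlongrightarrow> 0 *s X) (at 0)"
      by (rule bounded_linear.tendsto[OF bounded_linear_vector_scalar_mult_left tendsto_ident_at])
    then show ?thesis
      using \<rho> by (intro topological_tendstoD[where S = "ball 0 \<rho>"]) auto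
  qed
  define q where "q l = (1/l) *s (G (l *s X) *v u l)" for l
  have ev0: "\<forall>\<^sub>F l in at 0. cinner (q l) (\<xi> - G y *v \<tau>) = 0"
    using ev_det ev_ball
  proof eventually_elim
    case (elim l)
    define x where "x = l *s X"
    have "M l *v u l = b y"
      using cramer[OF elim(1)] by (simp add: u_def)
    then have u: "u l + conjugate_transpose (G y) *v (G x *v u l) = b y"
      by (simp add: M_def x_def matrix_vector_mult_add_rdistrib matrix_vector_mul_assoc)
    have "cinner (u l) (b x) = \<kappa>"
      using ident[of x y "u l"] elim y u by (simp add: x_def M_def)
    moreover have "cinner (u l) (b x) = cinner (u l) \<tau> + cinner (G x *v u l) \<xi>"
      by (simp add: b cinner_simps cinner_adjoint)
    \<comment> \<open>Pairing the equation for \<open>u l\<close> with \<open>\<tau>\<close> trades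
      the adjoint of \<open>G y\<close> for \<open>G y *v \<tau>\<close>. Since
      \<open>cinner (b y) \<tau> = \<kappa>\<close>, the constants cancel, and all that is left
      contains \<open>G x *v u l\<close>, which can be divided by \<open>l\<close>.\<close>
    moreover have "cinner (u l) \<tau> = cinner (b y) \<tau> - cinner (G x *v u l) (G y *v \<tau>)"
    proof -
      have "cinner (conjugate_transpose (G y) *v (G x *v u l)) \<tau> = cinner (G x *v u l) (G y *v \<tau>)"
        by (metis cinner_adjoint cinner_commute complex_cnj_cnj)
      then show ?thesis
        using arg_cong[OF u, of "\<lambda>v. cinner v \<tau>"] by (simp add: cinner_simps algebra_simps)
    qed
    ultimately have "cinner (G x *v u l) (\<xi> - G y *v \<tau>) = 0"
      using by0 by (simp add: cinner_simps algebra_simps)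
    then show ?case
      by (simp add: q_def x_def cinner_simps)
  qed
  have q_lim: "(q \<longlongrightarrow> Q X *v b y) (at 0)"
  proof (rule vec_tendstoI)
    fix i
    have "((\<lambda>l. G (l *s X) $ i $ j / l) \<longlongrightarrow> Q X $ i $ j) (at 0)" for j
      using Q[of X i j] G0 by (simp add: DERIV_def)
    then have "((\<lambda>l. \<Sum>j\<in>UNIV. (G (l *s X) $ i $ j / l) * u l $ j) \<longlongrightarrow> (\<Sum>j\<in>UNIV. Q X $ i $ j * b y $ j)) (at 0)"
      by (intro tendsto_sum tendsto_mult tendsto_vec_nth u_lim)
    then show "((\<lambda>l. q l $ i) \<longlongrightarrow> (Q X *v b y) $ i) (at 0)"
      by (simp add: q_def matrix_vector_mult_def sum_divide_distrib)
  qed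
  have "((\<lambda>l. cinner (q l) (\<xi> - G y *v \<tau>)) \<longlongrightarrow> cinner (Q X *v b y) (\<xi> - G y *v \<tau>)) (at 0)"
    by (intro tendsto_cinner q_lim tendsto_const)
  moreover have "((\<lambda>l. cinner (q l) (\<xi> - G y *v \<tau>)) \<longlongrightarrow> 0) (at 0)"
    using ev0 by (rule tendsto_eventually)
  ultimately show "cinner (Q X *v b y) (\<xi> - G y *v \<tau>) = 0"
    using tendsto_unique by (metis at_neq_bot)
qed

text \<open>Symmetry of \<open>Q\<close> makes \<open>cinner Z (A X)\<close> symmetric in
  \<open>X\<close> and \<open>Z\<close>. With it \<open>h1\<close> gives
  \<open>A \<tau> = 0\<close>, then \<open>h2\<close> gives \<open>Q \<tau> *v \<tau> = 0\<close>,
  which unlocks \<open>h3\<close>. Now \<open>h2\<close> and \<open>h3\<close> make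
  \<open>A Y\<close> and \<open>A (A Y)\<close> orthogonal; polarizing this yields
  \<open>A (A X) = 0\<close>, hence \<open>A X = 0\<close> by symmetry, and \<open>h2\<close>
  returns \<open>Q X *v \<tau> = 0\<close>.\<close>

lemma second_fundamental_form_vanishes:
  fixes Q :: "complex^'n \<Rightarrow> complex^'n^'n"
  assumes sym: "\<And>X Y. Q X *v Y = Q Y *v X"
    and A: "\<And>X. A X = conjugate_transpose (Q X) *v \<xi>"
    and h1: "\<And>X. cinner (Q X *v \<tau>) \<xi> = 0"
    and h2: "\<And>X Y. cinner (A Y) (A X) = cinner (Q X *v \<tau>) (Q Y *v \<tau>)"
    and h3: "Q \<tau> *v \<tau> = 0 \<Longrightarrow> (\<And>Y. cinner (Q \<tau> *v A Y) (Q Y *v \<tau>) = 0)"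
  shows "A X = 0" and "Q X *v \<tau> = 0"
proof -
  have A_adj: "cinner Z (A X) = cinner (Q X *v Z) \<xi>" for X Z
    by (simp add: A cinner_adjoint)
  have A_sym: "cinner Z (A X) = cinner X (A Z)" for X Z
    using sym by (simp add: A_adj)
  have "A \<tau> = 0"
    using A_adj[of "A \<tau>" \<tau>] sym[of \<tau>] h1 by (metis cinner_self_eq_0)
  then have "Q \<tau> *v \<tau> = 0"
    using h2[of \<tau> \<tau>] by simp
  note h3 = h3[OF this]
  have AA: "cinner (A Y) (A (A Y)) = 0" for Y
    using h2[of "A Y" Y, symmetric] h3[of Y] sym[of \<tau>] by (metis cinner_eq_0_commute)
  have A_add: "A (X + Y) = A X + A Y" for X Y
  proof (rule eq_if_cinner_eq)
    show "cinner z (A (X + Y)) = cinner z (A X + A Y)" for z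
      by (simp add: A_sym[of z] cinner_simps)
  qed
  \<comment> \<open>Expanding at \<open>X + Y\<close> leaves
    \<open>cinner (A X) (A (A Y)) + cinner (A Y) (A (A X)) = 0\<close>, and symmetry makes the two
    summands equal.\<close>
  have pol: "cinner (A X) (A (A Y)) = 0" for X Y
    using AA[of "X + Y"] AA[of X] AA[of Y] A_sym[of "A Y" "A X"] by (simp add: A_add cinner_simps)
  have "A (A X) = 0" for X
    using pol[of "A X" X] by simp
  then show A0: "A X = 0" for X
    using A_sym[of "A X" X] by simp
  then show "Q X *v \<tau> = 0"
    using h2[of X X] by simp
qed

text \<open>The first variation is expanded once more, now in \<open>y = l *s Y\<close>. Its
  constant term is \<open>h1\<close>, the coefficient of \<open>cnj l\<close> is \<open>h2\<close>,
  and for \<open>X = \<tau>\<close> the next term is \<open>h3\<close>; these feed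
  \<open>second_fundamental_form_vanishes\<close>. The second claim compares
  \<open>cinner (b x) \<tau> = \<kappa>\<close> at \<open>x\<close> and at 0.\<close>

lemma helix_graph_rigidity:
  fixes G :: "complex^'n \<Rightarrow> complex^'n^'n" and b :: "complex^'n \<Rightarrow> complex^'n"
  assumes hol: "\<And>m k i j. (\<lambda>l. G (m + l *s k) $ i $ j) holomorphic_on {l. m + l *s k \<in> ball 0 \<rho>}"
    and b: "\<And>x. b x = \<tau> + conjugate_transpose (G x) *v \<xi>"
    and diag: "\<And>x. x \<in> ball 0 \<rho> \<Longrightarrow> \<exists>u. u + conjugate_transpose (G x) *v (G x *v u) = b x \<and> cinner u (b x) = \<kappa>"
    and Q: "\<And>X i j. ((\<lambda>l. G (l *s X) $ i $ j) has_field_derivative Q X $ i $ j) (at 0)"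
    and sym: "\<And>X Y. Q X *v Y = Q Y *v X"
    and G0: "G 0 = 0" and \<rho>: "\<rho> > 0"
  shows "Q X *v \<tau> = 0" and "x \<in> ball 0 \<rho> \<Longrightarrow> cinner (G x *v \<tau>) \<xi> = 0"
proof -
  define A where "A X = conjugate_transpose (Q X) *v \<xi>" for X
  note first = first_variation_polarized[OF hol b diag Q G0 \<rho>]
  have b0: "b 0 = \<tau>"
    by (simp add: b G0 conjugate_transpose_def vec_eq_iff matrix_vector_mult_def)
  have h1: "cinner (Q X *v \<tau>) \<xi> = 0" for X
    using first(1)[of 0 X] \<rho> b0 G0 by simp
  \<comment> \<open>Rescaled increments with limits \<open>A Y\<close> and
    \<open>Q Y *v \<tau>\<close>. The adjoint depends on \<open>cnj l\<close>, hence the division by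
    the conjugate in \<open>a\<close>.\<close>
  define a where "a Y l = (1 / cnj l) *s (conjugate_transpose (G (l *s Y)) *v \<xi>)" for Y l
  define g where "g Y l = (1 / l) *s (G (l *s Y) *v \<tau>)" for Y l
  have q_lim: "((\<lambda>l. G (l *s X) $ i $ j / l) \<longlongrightarrow> Q X $ i $ j) (at 0)" for X i j
    using Q[of X i j] G0 by (simp add: DERIV_def)
  have a_lim: "(a Y \<longlongrightarrow> A Y) (at 0)" for Y
  proof (rule vec_tendstoI)
    fix i
    have "((\<lambda>l. \<Sum>j\<in>UNIV. cnj (G (l *s Y) $ j $ i / l) * \<xi> $ j) \<longlongrightarrow> (\<Sum>j\<in>UNIV. cnj (Q Y $ j $ i) * \<xi> $ j)) (at 0)"
      by (intro tendsto_intros q_lim)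
    then show "((\<lambda>l. a Y l $ i) \<longlongrightarrow> A Y $ i) (at 0)"
      by (simp add: a_def A_def matrix_vector_mult_def conjugate_transpose_def sum_divide_distrib)
  qed
  have g_lim: "(g Y \<longlongrightarrow> Q Y *v \<tau>) (at 0)" for Y
  proof (rule vec_tendstoI)
    fix i
    have "((\<lambda>l. \<Sum>j\<in>UNIV. (G (l *s Y) $ i $ j / l) * \<tau> $ j) \<longlongrightarrow> (\<Sum>j\<in>UNIV. Q Y $ i $ j * \<tau> $ j)) (at 0)"
      by (intro tendsto_intros q_lim)
    then show "((\<lambda>l. g Y l $ i) \<longlongrightarrow> (Q Y *v \<tau>) $ i) (at 0)"
      by (simp add: g_def matrix_vector_mult_def sum_divide_distrib)
  qed
  have ev_ball: "\<forall>\<^sub>F l in at 0. l \<noteq> 0 \<and> l *s Y \<in> ball 0 \<rho>" for Y :: "complex^'n"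
  proof -
    have "((\<lambda>l. l *s Y) \<longlongrightarrow> 0 *s Y) (at 0)"
      by (rule bounded_linear.tendsto[OF bounded_linear_vector_scalar_mult_left tendsto_ident_at])
    then have "\<forall>\<^sub>F l in at 0. l *s Y \<in> ball 0 \<rho>"
      using \<rho> by (intro topological_tendstoD[where S = "ball 0 \<rho>"]) auto
    then show ?thesis
      using eventually_neq_at_within[of 0 0 UNIV] by eventually_elim auto
  qed
  have mulQ: "((\<lambda>l. Q X *v f l) \<longlongrightarrow> Q X *v f0) (at 0)" if "(f \<longlongrightarrow> f0) (at 0)" for X f f0
    using bounded_linear.tendsto[OF matrix_vector_mul_bounded_linear that] .
  \<comment> \<open>The expansion divided by \<open>cnj l\<close>. As \<open>cinner\<close> is
    conjugate linear in its second slot, \<open>g\<close> too contributes a factor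
    \<open>cnj l\<close>.\<close>
  have exp: "cinner (Q X *v a Y l) \<xi> - cinner (Q X *v \<tau>) (g Y l) - cnj l * cinner (Q X *v a Y l) (g Y l) = 0"
    if "l \<noteq> 0" "l *s Y \<in> ball 0 \<rho>" for X Y l
  proof -
    have "b (l *s Y) = \<tau> + cnj l *s a Y l" "G (l *s Y) *v \<tau> = l *s g Y l"
      using that by (simp_all add: b a_def g_def vector_smult_assoc)
    then have "cinner (Q X *v (\<tau> + cnj l *s a Y l)) (\<xi> - l *s g Y l) = 0"
      using first(1)[of "l *s Y" X] that(2) by simp
    then have "cnj l * (cinner (Q X *v a Y l) \<xi> - cinner (Q X *v \<tau>) (g Y l) - cnj l * cinner (Q X *v a Y l) (g Y l)) = 0"
      using h1[of X] by (simp add: matrix_vector_right_distrib vector_scalar_commute cinner_simps algebra_simps)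
    then show ?thesis using that by simp
  qed
  have h2: "cinner (A Y) (A X) = cinner (Q X *v \<tau>) (Q Y *v \<tau>)" for X Y
  proof -
    have "((\<lambda>l. cinner (Q X *v a Y l) \<xi> - cinner (Q X *v \<tau>) (g Y l) - cnj l * cinner (Q X *v a Y l) (g Y l)) \<longlongrightarrow>
        cinner (Q X *v A Y) \<xi> - cinner (Q X *v \<tau>) (Q Y *v \<tau>) - cnj 0 * cinner (Q X *v A Y) (Q Y *v \<tau>)) (at 0)"
      by (intro tendsto_intros tendsto_cinner mulQ a_lim g_lim)
    moreover have "((\<lambda>l. cinner (Q X *v a Y l) \<xi> - cinner (Q X *v \<tau>) (g Y l) - cnj l * cinner (Q X *v a Y l) (g Y l)) \<longlongrightarrow> 0) (at 0)"
      by (rule tendsto_eventually) (use ev_ball[of Y] in \<open>eventually_elim, auto simp: exp\<close>)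
    ultimately have "cinner (Q X *v A Y) \<xi> - cinner (Q X *v \<tau>) (Q Y *v \<tau>) - cnj 0 * cinner (Q X *v A Y) (Q Y *v \<tau>) = 0"
      using tendsto_unique[OF at_neq_bot] by blast
    then show ?thesis
      by (simp add: A_def cinner_adjoint)
  qed
  \<comment> \<open>For \<open>X = \<tau>\<close> the two leading terms vanish, one by
    \<open>h1\<close> with symmetry and one by the assumption, and what remains can be divided by
    \<open>cnj l\<close> once more.\<close>
  have h3: "cinner (Q \<tau> *v A Y) (Q Y *v \<tau>) = 0" if "Q \<tau> *v \<tau> = 0" for Y
  proof -
    have "((\<lambda>l. cinner (Q \<tau> *v a Y l) (g Y l)) \<longlongrightarrow> cinner (Q \<tau> *v A Y) (Q Y *v \<tau>)) (at 0)"
      by (intro tendsto_intros tendsto_cinner mulQ a_lim g_lim)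
    moreover have "cinner (Q \<tau> *v a Y l) (g Y l) = 0" if "l \<noteq> 0" "l *s Y \<in> ball 0 \<rho>" for l
      using exp[OF that, of \<tau>] \<open>Q \<tau> *v \<tau> = 0\<close> sym[of \<tau> "a Y l"] h1[of "a Y l"] that by simp
    then have "((\<lambda>l. cinner (Q \<tau> *v a Y l) (g Y l)) \<longlongrightarrow> 0) (at 0)"
      by (intro tendsto_eventually) (use ev_ball[of Y] in \<open>eventually_elim, auto\<close>)
    ultimately show ?thesis
      using tendsto_unique[OF at_neq_bot] by blast
  qed
  show "Q X *v \<tau> = 0"
    using second_fundamental_form_vanishes(2)[OF sym A_def h1 h2 h3] .
  show "cinner (G x *v \<tau>) \<xi> = 0" if "x \<in> ball 0 \<rho>"
  proof -
    have "cinner \<tau> \<tau> + cinner (conjugate_transpose (G x) *v \<xi>) \<tau> = cinner \<tau> \<tau>"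
      using first(2)[of x] first(2)[of 0] that \<rho> b0 by (simp add: b cinner_simps)
    then have "cinner (conjugate_transpose (G x) *v \<xi>) \<tau> = 0"
      by simp
    then show ?thesis
      unfolding cinner_adjoint[of "G x"] using cinner_eq_0_commute by blast
  qed
qed

section \<open>Graph charts\<close>

lemma vec_subspace_matrix_image:
  fixes A :: "complex^'n^'k"
  assumes L: "vec.subspace L"
  shows "vec.subspace ((*v) A ` L)"
  unfolding vec.subspace_def
proof (intro conjI ballI allI)
  show "0 \<in> (*v) A ` L"
    using vec.subspace_0[OF L] by (auto intro!: image_eqI[of _ _ 0])
next
  fix x y assume "x \<in> (*v) A ` L" "y \<in> (*v) A ` L"
  then obtain a b where "a \<in> L" "b \<in> L" "x = A *v a" "y = A *v b" by auto
  then show "x + y \<in> (*v) A ` L"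
    using vec.subspace_add[OF L] by (intro image_eqI[of _ _ "a + b"]) (auto simp: matrix_vector_right_distrib)
next
  fix c x assume "x \<in> (*v) A ` L"
  then obtain a where "a \<in> L" "x = A *v a" by auto
  then show "c *s x \<in> (*v) A ` L"
    using vec.subspace_scale[OF L] by (intro image_eqI[of _ _ "c *s a"]) (auto simp: vector_scalar_commute)
qed

lemma cinner_self_adjoint: "conjugate_transpose P = P \<Longrightarrow> cinner (P *v x) y = cinner x (P *v y)"
  by (simp add: cinner_adjoint)

lemma norm_orthogonal_projection_le:
  assumes "P ** P = P" "conjugate_transpose P = P"
  shows "norm (P *v x) \<le> norm (x :: complex^'n)"
proof -
  have "cinner (P *v x) (x - P *v x) = 0"
    using assms(1) by (simp add: cinner_self_adjoint[OF assms(2)] matrix_vector_mult_diff_distrib matrix_vector_mul_assoc)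
  then have "(P *v x) \<bullet> (x - P *v x) = 0"
    by (metis Re_cinner zero_complex.sel(1))
  then have "norm (P *v x + (x - P *v x)) ^ 2 = norm (P *v x) ^ 2 + norm (x - P *v x) ^ 2"
    by (intro norm_add_Pythagorean) (simp add: orthogonal_def)
  then show ?thesis
    using power2_le_imp_le[of "norm (P *v x)" "norm x"] by simp
qed

lemma vec_subspace_imp_subspace: "vec.subspace T \<Longrightarrow> subspace (T :: (complex^'n) set)"
  by (auto simp: subspace_def vec.subspace_def scaleR_eq_vector_scalar_mult)

text \<open>A complex subspace contains \<open>\<i> *s v\<close> along with \<open>v\<close>, so
  real orthogonality kills the imaginary part of \<open>cinner w v\<close> as well.\<close>

lemma cinner_eq_0_if_orthogonal:
  assumes "vec.subspace T" "\<And>v. v \<in> T \<Longrightarrow> orthogonal w v" "v \<in> T"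
  shows "cinner w v = 0"
  using assms vec.subspace_scale[OF assms(1,3), of \<i>]
  by (simp add: cinner_eq_inner orthogonal_def complex_eq_iff)

text \<open>The real orthogonal decomposition is also a Hermitian one; uniqueness of the component
  in \<open>T\<close> makes the projection complex linear, hence a matrix.\<close>

lemma orthogonal_projection_exists:
  fixes T :: "(complex^'n) set"
  assumes T: "vec.subspace T"
  obtains P where "P ** P = P" "conjugate_transpose P = P" "range ((*v) P) = T"
proof -
  have "\<exists>y. y \<in> T \<and> (\<forall>v\<in>T. cinner (x - y) v = 0)" for x
  proof -
    obtain y z where yz: "y \<in> span T" "\<And>w. w \<in> span T \<Longrightarrow> orthogonal z w" "x = y + z"
      using orthogonal_subspace_decomp_exists[of T x] by metis
    have "w \<in> span T \<longleftrightarrow> w \<in> T" for w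
      using vec_subspace_imp_subspace[OF T] by (metis span_eq_iff)
    then show ?thesis
      using yz cinner_eq_0_if_orthogonal[OF T, of z] by (intro exI[of _ y]) auto
  qed
  then obtain f where f: "\<And>x. f x \<in> T" "\<And>x v. v \<in> T \<Longrightarrow> cinner (x - f x) v = 0"
    by metis
  have uniq: "f x = y" if "y \<in> T" "\<And>v. v \<in> T \<Longrightarrow> cinner (x - y) v = 0" for x y
  proof -
    have in_T: "f x - y \<in> T"
      by (rule vec.subspace_diff[OF T f(1) that(1)])
    have "cinner ((x - y) - (x - f x)) (f x - y) = 0"
      by (simp only: cinner_diff_left[of "x - y"] that(2)[OF in_T] f(2)[OF in_T] diff_zero)
    then show ?thesis by simp
  qed
  have "Vector_Spaces.linear (*s) (*s) f"
  proof (unfold_locales)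
    show "f (x + y) = f x + f y" for x y
    proof (rule uniq)
      show "f x + f y \<in> T" using f T by (simp add: vec.subspace_add)
      fix v assume "v \<in> T"
      then have "cinner ((x - f x) + (y - f y)) v = 0"
        by (simp only: cinner_add_left f(2) add_0)
      then show "cinner (x + y - (f x + f y)) v = 0" by (simp add: algebra_simps)
    qed
    show "f (c *s x) = c *s f x" for c x
    proof (rule uniq)
      show "c *s f x \<in> T" using f T by (simp add: vec.subspace_scale)
      fix v assume "v \<in> T"
      then have "cinner (c *s (x - f x)) v = 0"
        by (simp only: cinner_scale_left f(2) mult_zero_right)
      then show "cinner (c *s x - c *s f x) v = 0" by (simp add: vec.scale_right_diff_distrib)
    qed
  qed
  then have P: "matrix f *v x = f x" for x by (rule matrix_works)
  have fT: "f v = v" if "v \<in> T" for v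
    using uniq[of v v] that by simp
  show ?thesis
  proof (rule that[of "matrix f"])
    show "matrix f ** matrix f = matrix f"
      by (simp add: matrix_eq P fT f flip: matrix_vector_mul_assoc)
    have "cinner z (conjugate_transpose (matrix f) *v x) = cinner z (matrix f *v x)" for z x
    proof -
      have "cinner (f z) (x - f x) = 0" "cinner (z - f z) (f x) = 0"
        using f cinner_eq_0_commute by blast+
      then show ?thesis by (simp add: P cinner_simps flip: cinner_adjoint)
    qed
    then show "conjugate_transpose (matrix f) = matrix f"
      unfolding matrix_eq by (blast intro: eq_if_cinner_eq)
    show "range ((*v) (matrix f)) = T"
    proof (intro subset_antisym subsetI)
      show "v \<in> T" if "v \<in> range ((*v) (matrix f))" for v
        using that f(1) by (auto simp: P)
      show "v \<in> range ((*v) (matrix f))" if "v \<in> T" for v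
        using fT[OF that] by (metis P rangeI)
    qed
  qed
qed

text \<open>Near \<open>p\<close>, \<open>M\<close> is the graph of \<open>g\<close> over the range of the orthogonal projection \<open>P\<close>;
  \<open>g\<close> is extended to a ball of the whole space by precomposition with \<open>P\<close>.\<close>

definition graph_chart ::
    "(complex^'n) set \<Rightarrow> complex^'n \<Rightarrow> complex^'n^'n \<Rightarrow> real \<Rightarrow> (complex^'n \<Rightarrow> complex^'n) \<Rightarrow> (complex^'n) set \<Rightarrow> bool"
  where "graph_chart M p P \<rho> g W \<longleftrightarrow>
    P ** P = P \<and> conjugate_transpose P = P \<and> \<rho> > 0 \<and> open W \<and> p \<in> W \<and>
    holomorphic_map_on g (ball 0 \<rho>) \<and> (\<forall>x. P *v g x = 0) \<and> (\<forall>x. g (P *v x) = g x) \<and>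
    g 0 = 0 \<and> (g has_derivative (\<lambda>x. 0)) (at 0) \<and>
    (\<forall>z\<in>W. norm (P *v (z - p)) < \<rho>) \<and>
    (\<forall>z\<in>W. z \<in> M \<longleftrightarrow> z - p = P *v (z - p) + g (P *v (z - p))) \<and>
    (\<forall>x\<in>ball 0 \<rho>. p + P *v x + g x \<in> W)"

text \<open>The real inverse function theorem wants a continuous derivative, supplied by the
  regularity of the Jacobian. The derivative of the inverse map is the inverse of a complex matrix,
  hence again complex linear.\<close>

lemma holomorphic_local_inverse:
  fixes \<Psi> :: "complex^'n \<Rightarrow> complex^'n" and D :: "complex^'n \<Rightarrow> complex^'n^'n"
  assumes U: "open U" "p \<in> U"
    and der: "\<And>x. x \<in> U \<Longrightarrow> (\<Psi> has_derivative (*v) (D x)) (at x)"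
    and Dp: "D p = mat 1"
  obtains U' V \<Theta> E where "open U'" "U' \<subseteq> U" "p \<in> U'" "open V" "\<Psi> p \<in> V" "homeomorphism U' V \<Psi> \<Theta>"
    "\<And>y. y \<in> V \<Longrightarrow> (\<Theta> has_derivative (*v) (E y)) (at y)" "E (\<Psi> p) = mat 1"
proof -
  define bl :: "complex^'n^'n \<Rightarrow> (complex^'n) \<Rightarrow>\<^sub>L (complex^'n)" where "bl A = Blinfun ((*v) A)" for A
  have bl: "blinfun_apply (bl A) = (*v) A" for A
    by (simp add: bl_def bounded_linear_Blinfun_apply)
  have "linear bl"
    by (intro linearI blinfun_eqI)
       (auto simp: bl blinfun.bilinear_simps matrix_vector_mult_add_rdistrib
        vec_eq_iff matrix_vector_mult_def scaleR_sum_right algebra_simps sum.distrib)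
  then have bl_cont: "continuous_on UNIV bl"
    by (intro linear_continuous_on) (simp add: linear_conv_bounded_linear)
  obtain Q where Q: "\<And>x i j. x \<in> U \<Longrightarrow> ((\<lambda>x. D x $ i $ j) has_derivative (\<lambda>X. Q x X $ i $ j)) (at x)"
    by (rule jacobian_regular[OF U(1)]) (erule der, rule that)
  have "(D has_derivative Q x) (at x)" if "x \<in> U" for x
    by (intro has_derivative_vecI Q that)
  then have "continuous_on U D"
    by (meson continuous_at_imp_continuous_on has_derivative_continuous)
  then have c: "continuous_on U (\<lambda>x. bl (D x))"
    by (rule continuous_on_compose2[OF bl_cont]) auto
  have i: "bl (mat 1) o\<^sub>L bl (D p) = id_blinfun"
    by (intro blinfun_eqI) (simp add: bl Dp)
  have d: "(\<Psi> has_derivative blinfun_apply (bl (D x))) (at x)" if "x \<in> U" for x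
    using der[OF that] by (simp add: bl)
  obtain U' V \<Theta> \<Theta>' where *: "open U'" "U' \<subseteq> U" "p \<in> U'" "open V" "\<Psi> p \<in> V" "homeomorphism U' V \<Psi> \<Theta>"
    "\<And>y. y \<in> V \<Longrightarrow> (\<Theta> has_derivative \<Theta>' y) (at y)"
    "\<And>y. y \<in> V \<Longrightarrow> \<Theta>' y = inv (blinfun_apply (bl (D (\<Theta> y))))"
    "\<And>y. y \<in> V \<Longrightarrow> bij (blinfun_apply (bl (D (\<Theta> y))))"
    by (rule inverse_function_theorem[OF U(1) _ c U(2) i]) (erule d, rule that)
  have "\<exists>B. \<Theta>' y = (*v) B" if "y \<in> V" for y
  proof -
    have "bij ((*v) (D (\<Theta> y)))" using *(9)[OF that] by (simp add: bl)
    then obtain B where B: "B ** D (\<Theta> y) = mat 1"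
      using matrix_left_invertible_injective bij_is_inj by metis
    then have "D (\<Theta> y) ** B = mat 1"
      by (simp add: matrix_left_right_inverse)
    with B have "inv ((*v) (D (\<Theta> y))) = (*v) B"
      by (intro inv_equality) (simp_all add: matrix_vector_mul_assoc)
    then show ?thesis using *(8)[OF that] by (auto simp: bl)
  qed
  then obtain E where E: "\<And>y. y \<in> V \<Longrightarrow> \<Theta>' y = (*v) (E y)" by metis
  have "\<Theta> (\<Psi> p) = p"
    using *(3,6) by (simp add: homeomorphism_apply1)
  then have "(*v) (E (\<Psi> p)) = inv ((*v) (mat 1 :: complex^'n^'n))"
    using *(5,8) E by (simp add: bl Dp)
  then have "E (\<Psi> p) = mat 1"
    using inv_id by (simp add: matrix_eq fun_eq_iff matrix_vector_mul_lid[abs_def] id_def)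
  then show ?thesis
    using that[OF *(1-6), of E] *(7) E by simp
qed

text \<open>The straightening \<open>F\<close> is replaced by a map \<open>\<Psi>\<close> that keeps
  the coordinate along the tangent space \<open>T\<close> and records in the normal direction the
  failure to lie in \<open>M\<close>. Its derivative at \<open>p\<close> is the identity, and its
  local inverse, restricted to \<open>T\<close>, parametrizes \<open>M\<close> as a graph over
  \<open>T\<close>.\<close>

lemma complex_submanifold_graph_chart:
  fixes M :: "(complex^'n) set"
  assumes "complex_submanifold UNIV m M" "p \<in> M"
  obtains P \<rho> g W where "graph_chart M p P \<rho> g W" "vec.dim (range ((*v) P)) = m"
proof -
  obtain U V and L :: "(complex^'n) set" and F G where U: "p \<in> U" "open U" and V: "open V"
    and L: "vec.subspace L" "L \<subseteq> UNIV" "vec.dim L = m" and hom: "homeomorphism U V F G"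
    and F: "holomorphic_map_on F U" and G: "holomorphic_map_on G V" and FM: "F ` (M \<inter> U) = L \<inter> V"
    using assms(1)[unfolded complex_submanifold_def subtopology_UNIV open_openin[symmetric],
        THEN conjunct2, THEN conjunct2, THEN bspec, OF assms(2)]
    by (elim exE conjE) (rule that)
  obtain DF where DF: "\<And>x. x \<in> U \<Longrightarrow> (F has_derivative (*v) (DF x)) (at x)"
    using holomorphic_map_onE[OF F U(2)] by blast
  obtain DG where DG: "\<And>x. x \<in> V \<Longrightarrow> (G has_derivative (*v) (DG x)) (at x)"
    using holomorphic_map_onE[OF G V] by blast
  have FV: "F x \<in> V" and GF: "G (F x) = x" if "x \<in> U" for x
    using hom that by (auto simp: homeomorphism_def)
  have M_iff: "x \<in> M \<longleftrightarrow> F x \<in> L" if x: "x \<in> U" for x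
  proof
    assume "F x \<in> L"
    then have "F x \<in> F ` (M \<inter> U)"
      using FV[OF x] FM by blast
    then obtain y where y: "y \<in> M" "y \<in> U" "F y = F x"
      by auto
    then have "y = x"
      using GF[OF x] GF[OF y(2)] by simp
    with y show "x \<in> M" by simp
  qed (use FM x in blast)
  \<comment> \<open>\<open>E\<close> inverts the derivative of \<open>F\<close> at \<open>p\<close>,
    so \<open>E *v (F x - F p)\<close> agrees with \<open>x - p\<close> to first order, and it
    carries the model plane \<open>L\<close> to the tangent space.\<close>
  define E where "E = DG (F p)"
  have EF: "E ** DF p = mat 1"
  proof -
    have "((\<lambda>x. G (F x)) has_derivative (\<lambda>X. DG (F p) *v (DF p *v X))) (at p)"
      using has_derivative_compose[OF DF[OF U(1)] DG[OF FV[OF U(1)]]] .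
    moreover have "((\<lambda>x. G (F x)) has_derivative (\<lambda>X. X)) (at p)"
      by (rule has_derivative_transform_within_open[OF has_derivative_ident U(2,1)]) (simp add: GF)
    ultimately have "(\<lambda>X. DG (F p) *v (DF p *v X)) = (\<lambda>X. X)"
      by (rule has_derivative_unique)
    then show ?thesis
      by (simp add: matrix_eq E_def fun_eq_iff flip: matrix_vector_mul_assoc)
  qed
  then have FE: "DF p ** E = mat 1"
    by (simp add: matrix_left_right_inverse)
  define T where "T = (*v) E ` L"
  have T: "vec.subspace T"
    unfolding T_def by (rule vec_subspace_matrix_image[OF L(1)])
  have "inj ((*v) E)"
    using FE matrix_left_invertible_injective by blast
  then have dimT: "vec.dim T = m"
    unfolding T_def L(3)[symmetric]
    using vec.dim_image_eq[OF matrix_vector_mul_linear_gen, of E L] by (auto intro: inj_on_subset)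
  have ET: "E *v y \<in> T \<longleftrightarrow> y \<in> L" for y
    using \<open>inj ((*v) E)\<close> by (auto simp: T_def inj_image_mem_iff)
  obtain P where P: "P ** P = P" "conjugate_transpose P = P" "range ((*v) P) = T"
    using orthogonal_projection_exists[OF T] .
  have PP: "P *v (P *v x) = P *v x" for x
    using P by (simp add: matrix_vector_mul_assoc)
  have PT: "P *v x = x \<longleftrightarrow> x \<in> T" for x
  proof
    assume "P *v x = x"
    then show "x \<in> T" using P(3) rangeI[of "(*v) P" x] by simp
  next
    assume "x \<in> T"
    then obtain y where "x = P *v y" using P(3) by auto
    then show "P *v x = x" by (simp add: PP)
  qed
  define R where "R = mat 1 - P"
  have R: "R *v x = x - P *v x" for x
    by (simp add: R_def matrix_vector_mult_diff_rdistrib)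
  have PR: "P *v (R *v x) = 0" "R *v (P *v x) = 0" for x
    by (simp_all add: R matrix_vector_mult_diff_distrib PP)
  \<comment> \<open>The first summand is the tangential coordinate; for \<open>x\<close> in
    \<open>U\<close> the second vanishes exactly when \<open>F x - F p\<close> lies in
    \<open>L\<close>, that is, when \<open>x\<close> lies in \<open>M\<close>.\<close>
  define \<Psi> where "\<Psi> x = P *v (x - p) + R *v (E *v (F x - F p))" for x
  have P\<Psi>: "P *v \<Psi> x = P *v (x - p)" for x
    by (simp add: \<Psi>_def matrix_vector_right_distrib PP PR)
  have "(\<Psi> has_derivative (*v) (P + R ** (E ** DF x))) (at x)" if "x \<in> U" for x
  proof -
    have "((\<lambda>x. P *v (x - p) + R *v (E *v (F x - F p))) has_derivative 
        (\<lambda>X. P *v (X - 0) + R *v (E *v (DF x *v X - 0)))) (at x)"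
      by (intro has_derivative_add has_derivative_diff has_derivative_ident has_derivative_const DF that
         bounded_linear.has_derivative[OF matrix_vector_mul_bounded_linear])
    then show ?thesis
      by (simp add: \<Psi>_def[abs_def] matrix_vector_mult_add_rdistrib[abs_def] matrix_vector_mul_assoc)
  qed
  moreover have "P + R ** (E ** DF p) = mat 1"
    by (simp add: EF R_def)
  ultimately obtain U' V' \<Theta> D where U': "open U'" "U' \<subseteq> U" "p \<in> U'" and V': "open V'" "\<Psi> p \<in> V'"
    and hom': "homeomorphism U' V' \<Psi> \<Theta>"
    and D: "\<And>y. y \<in> V' \<Longrightarrow> (\<Theta> has_derivative (*v) (D y)) (at y)" "D (\<Psi> p) = mat 1"
    using holomorphic_local_inverse[OF U(2,1), of \<Psi> "\<lambda>x. P + R ** (E ** DF x)"] by metis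
  have \<Psi>p: "\<Psi> p = 0" by (simp add: \<Psi>_def)
  have \<Theta>: "\<Theta> y \<in> U'" "\<Psi> (\<Theta> y) = y" if "y \<in> V'" for y
    using hom' that by (auto simp: homeomorphism_def)
  have \<Theta>\<Psi>: "\<Theta> (\<Psi> x) = x" if "x \<in> U'" for x
    using hom' that by (auto simp: homeomorphism_def)
  obtain \<rho> where \<rho>: "\<rho> > 0" "ball 0 \<rho> \<subseteq> V'"
    using V' \<Psi>p open_contains_ball_eq by metis
  have P_ball: "P *v x \<in> ball 0 \<rho>" if "x \<in> ball 0 \<rho>" for x
    using that norm_orthogonal_projection_le[OF P(1,2), of x] by simp
  define g where "g x = R *v (\<Theta> (P *v x) - p)" for x
  define W where "W = U' \<inter> {z. norm (P *v (z - p)) < \<rho>}"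
  have \<Theta>g: "\<Theta> (P *v x) - p = P *v x + g x" if "x \<in> ball 0 \<rho>" for x
  proof -
    have "P *v x \<in> V'" using P_ball[OF that] \<rho> by auto
    then have "P *v (\<Theta> (P *v x) - p) = P *v x"
      using P\<Psi>[of "\<Theta> (P *v x)"] \<Theta> by (simp add: PP)
    then show ?thesis
      unfolding g_def R by (simp add: algebra_simps)
  qed
  have g_der: "(g has_derivative (*v) (R ** (D (P *v x) ** P))) (at x)" if "x \<in> ball 0 \<rho>" for x
  proof -
    have "P *v x \<in> V'" using P_ball[OF that] \<rho> by auto
    have "((\<lambda>x. \<Theta> (P *v x)) has_derivative (\<lambda>X. D (P *v x) *v (P *v X))) (at x)"
      by (rule has_derivative_compose[OF bounded_linear_imp_has_derivative[OF matrix_vector_mul_bounded_linear]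
            D(1)[OF \<open>P *v x \<in> V'\<close>]])
    then have "((\<lambda>x. R *v (\<Theta> (P *v x) - p)) has_derivative (\<lambda>X. R *v (D (P *v x) *v (P *v X) - 0))) (at x)"
      by (intro bounded_linear.has_derivative[OF matrix_vector_mul_bounded_linear] has_derivative_diff has_derivative_const)
    then show ?thesis
      by (simp add: g_def[abs_def] matrix_vector_mul_assoc matrix_mul_assoc)
  qed
  have "graph_chart M p P \<rho> g W"
    unfolding graph_chart_def
  proof (intro conjI ballI allI)
    have "continuous_on UNIV (\<lambda>z. norm (P *v (z - p)))"
      by (intro continuous_on_norm bounded_linear.continuous_on[OF matrix_vector_mul_bounded_linear]
          continuous_intros)
    then show "open W" unfolding W_def
      by (intro open_Int U' open_Collect_less continuous_on_const)
    show "p \<in> W" using U' \<rho> by (simp add: W_def)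
    show "holomorphic_map_on g (ball 0 \<rho>)" by (rule holomorphic_map_onI[OF g_der])
    show "P *v g x = 0" "g (P *v x) = g x" for x by (simp_all add: g_def PR PP)
    show "g 0 = 0" using \<Theta>\<Psi>[OF U'(3)] by (simp add: g_def \<Psi>p)
    have "R ** (D (P *v 0) ** P) = 0"
      using D(2) PR by (simp add: \<Psi>p matrix_eq flip: matrix_vector_mul_assoc)
    moreover have "(*v) 0 = (\<lambda>x :: complex^'n. 0 :: complex^'n)"
      by (simp add: fun_eq_iff)
    ultimately show "(g has_derivative (\<lambda>x. 0)) (at 0)" using g_der[of 0] \<rho> by simp
  next
    fix z assume z: "z \<in> W"
    then show n: "norm (P *v (z - p)) < \<rho>" by (simp add: W_def)
    define y where "y = P *v (z - p)"
    have y: "y \<in> ball 0 \<rho>" "P *v y = y" using n by (simp_all add: y_def PP)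
    have zU: "z \<in> U" "z \<in> U'" using z U' by (auto simp: W_def)
    have "z \<in> M \<longleftrightarrow> F z - F p \<in> L"
    proof -
      have "F p \<in> L" using M_iff[OF U(1)] assms(2) by simp
      then show ?thesis
        using M_iff[OF zU(1)] vec.subspace_diff[OF L(1), of "F z" "F p"]
          vec.subspace_add[OF L(1), of "F z - F p" "F p"] by auto
    qed
    also have "\<dots> \<longleftrightarrow> R *v (E *v (F z - F p)) = 0"
      unfolding R ET[symmetric] PT[symmetric] by auto
    also have "\<dots> \<longleftrightarrow> \<Psi> z = y"
      by (simp add: \<Psi>_def y_def)
    also have "\<dots> \<longleftrightarrow> z = \<Theta> y"
      using \<Theta>\<Psi>[OF zU(2)] \<Theta>[of y] y(1) \<rho>(2) by auto
    also have "\<dots> \<longleftrightarrow> z - p = y + g y"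
    proof -
      have "\<Theta> y = p + (y + g y)"
        using \<Theta>g[OF y(1)] unfolding y(2) by (simp add: algebra_simps)
      then show ?thesis by (simp add: diff_eq_eq add.commute)
    qed
    finally show "z \<in> M \<longleftrightarrow> z - p = P *v (z - p) + g (P *v (z - p))"
      by (simp add: y_def)
  next
    fix x :: "complex^'n" assume x: "x \<in> ball 0 \<rho>"
    have "p + P *v x + g x = \<Theta> (P *v x)"
      using \<Theta>g[OF x] by (simp add: algebra_simps)
    moreover have "\<Theta> (P *v x) \<in> U'" using \<Theta>(1) P_ball[OF x] \<rho> by auto
    moreover have "P *v (\<Theta> (P *v x) - p) = P *v x"
      unfolding \<Theta>g[OF x] by (simp add: matrix_vector_right_distrib PP g_def PR)
    ultimately show "p + P *v x + g x \<in> W"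
      using P_ball[OF x] by (simp add: W_def)
  qed (use P \<rho> in auto)
  then show ?thesis
    using that P(3) dimT by blast
qed

text \<open>Straight lines in the parameter ball lift to curves in \<open>M\<close>, which gives one
  inclusion. Conversely, a curve in \<open>M\<close> is recovered from its own projection by the
  graph equation, and differentiating that equation exhibits its velocity. The two matrix identities
  come from differentiating \<open>g (P *v x) = g x\<close> and \<open>P *v g x = 0\<close>.\<close>

lemma graph_chart_tangent_space:
  assumes chart: "graph_chart M p P \<rho> g W" and x: "x \<in> ball 0 \<rho>"
    and G: "(g has_derivative (*v) G) (at x)"
  shows "tangent_space M (p + P *v x + g x) = range (\<lambda>X. P *v X + G *v X)"
    and "G ** P = G" and "P ** G = 0"
proof -
  from chart have P: "P ** P = P" and W: "open W"
    and Pg: "\<And>x. P *v g x = 0" and gP: "\<And>x. g (P *v x) = g x"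
    and MW: "\<And>z. z \<in> W \<Longrightarrow> z \<in> M \<longleftrightarrow> z - p = P *v (z - p) + g (P *v (z - p))"
    and inW: "\<And>x. x \<in> ball 0 \<rho> \<Longrightarrow> p + P *v x + g x \<in> W"
    unfolding graph_chart_def by auto
  have PP: "P *v (P *v x) = P *v x" for x
    using P by (simp add: matrix_vector_mul_assoc)
  have inM: "p + P *v x + g x \<in> M" if "x \<in> ball 0 \<rho>" for x
    using MW[OF inW[OF that]] by (simp add: matrix_vector_right_distrib PP Pg gP algebra_simps)
  note blmul = bounded_linear.has_derivative[OF matrix_vector_mul_bounded_linear]
  have gx: "g (x + P *v (y - x)) = g y" for y
  proof -
    have "P *v (x + P *v (y - x)) = P *v y"
      by (simp add: matrix_vector_right_distrib PP matrix_vector_mult_diff_distrib)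
    then show ?thesis
      using gP[of "x + P *v (y - x)"] gP[of y] by argo
  qed
  show GP: "G ** P = G"
  proof -
    have 1: "((\<lambda>y. x + P *v (y - x)) has_derivative (\<lambda>Y. 0 + P *v (Y - 0))) (at x)"
      by (intro has_derivative_add has_derivative_const blmul has_derivative_diff has_derivative_ident)
    have 2: "(g has_derivative (*v) G) (at (x + P *v (x - x)))" using G by simp
    have "((\<lambda>y. g (x + P *v (y - x))) has_derivative (\<lambda>Y. G *v (0 + P *v (Y - 0)))) (at x)"
      by (rule has_derivative_compose[OF 1 2])
    then have "(*v) G = (\<lambda>Y. G *v (P *v Y))"
      using G by (intro has_derivative_unique[of g _ x]) (simp_all add: gx)
    then show ?thesis
      by (simp add: matrix_eq fun_eq_iff flip: matrix_vector_mul_assoc)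
  qed
  show "P ** G = 0"
  proof -
    have "((\<lambda>y. P *v g y) has_derivative (\<lambda>Y. P *v (G *v Y))) (at x)"
      by (intro blmul G)
    then have "(\<lambda>Y. P *v (G *v Y)) = (\<lambda>Y. 0)"
      by (intro has_derivative_unique[of "\<lambda>y. P *v g y" _ x]) (simp_all add: Pg)
    then show ?thesis
      by (simp add: matrix_eq fun_eq_iff flip: matrix_vector_mul_assoc)
  qed
  show "tangent_space M (p + P *v x + g x) = range (\<lambda>X. P *v X + G *v X)"
  proof (intro subset_antisym subsetI)
    fix v assume "v \<in> range (\<lambda>X. P *v X + G *v X)"
    then obtain X where v: "v = P *v X + G *v X" by auto
    define \<gamma> where "\<gamma> t = p + P *v (x + t *\<^sub>R X) + g (x + t *\<^sub>R X)" for t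
    define r where "r = \<rho> - norm x"
    have r: "r > 0" using x by (simp add: r_def)
    have X1: "norm X + 1 > 0" by (smt (verit) norm_ge_zero)
    have "\<gamma> t \<in> M" if "t \<in> {- (r / (norm X + 1))<..<r / (norm X + 1)}" for t
    proof -
      have "\<bar>t\<bar> < r / (norm X + 1)" using that by auto
      then have "\<bar>t\<bar> * (norm X + 1) < r" using X1 by (simp add: pos_less_divide_eq)
      moreover have "\<bar>t\<bar> * norm X \<le> \<bar>t\<bar> * (norm X + 1)" by (intro mult_left_mono) auto
      ultimately have "norm (x + t *\<^sub>R X) < \<rho>"
        using norm_triangle_ineq[of x "t *\<^sub>R X"] by (simp add: r_def)
      then show ?thesis unfolding \<gamma>_def by (intro inM) simp
    qed
    moreover have "(\<gamma> has_vector_derivative v) (at 0)"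
    proof -
      have 1: "((\<lambda>t. x + t *\<^sub>R X) has_derivative (\<lambda>t. 0 + t *\<^sub>R X)) (at 0)"
        by (intro has_derivative_add has_derivative_const has_derivative_scaleR_left has_derivative_ident)
      have 2: "(g has_derivative (*v) G) (at (x + 0 *\<^sub>R X))" using G by simp
      have "((\<lambda>t. g (x + t *\<^sub>R X)) has_derivative (\<lambda>t. G *v (0 + t *\<^sub>R X))) (at 0)"
        by (rule has_derivative_compose[OF 1 2])
      then have "(\<gamma> has_derivative (\<lambda>t. 0 + P *v (0 + t *\<^sub>R X) + G *v (0 + t *\<^sub>R X))) (at 0)"
        unfolding \<gamma>_def by (intro has_derivative_add has_derivative_const blmul 1)
      moreover have "(\<lambda>t. 0 + P *v (0 + t *\<^sub>R X) + G *v (0 + t *\<^sub>R X)) = (\<lambda>t. t *\<^sub>R v)"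
        by (simp add: v scaleR_eq_vector_scalar_mult vector_scalar_commute vec.scale_right_distrib)
      ultimately show ?thesis by (simp add: has_vector_derivative_def)
    qed
    ultimately show "v \<in> tangent_space M (p + P *v x + g x)"
      unfolding tangent_space_def using r X1
      by (intro CollectI exI[of _ \<gamma>] exI[of _ "r / (norm X + 1)"]) (auto simp: \<gamma>_def)
  next
    fix v assume "v \<in> tangent_space M (p + P *v x + g x)"
    then obtain \<gamma> \<epsilon> where \<gamma>: "\<epsilon> > 0" "\<gamma> ` {-\<epsilon><..<\<epsilon>} \<subseteq> M" "\<gamma> 0 = p + P *v x + g x"
      "(\<gamma> has_vector_derivative v) (at 0)"
      unfolding tangent_space_def by auto
    have d\<gamma>: "(\<gamma> has_derivative (\<lambda>t. t *\<^sub>R v)) (at 0)"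
      using \<gamma>(4) by (simp add: has_vector_derivative_def)
    have "\<gamma> \<midarrow>0\<rightarrow> \<gamma> 0"
      using has_derivative_continuous[OF d\<gamma>] by (simp add: continuous_at)
    then have "\<forall>\<^sub>F t in at 0. \<gamma> t \<in> W"
      using topological_tendstoD[OF _ W] \<gamma>(3) inW[OF x] by simp
    moreover have "\<forall>\<^sub>F t in at (0::real). t \<in> {-\<epsilon><..<\<epsilon>}"
      using \<gamma>(1) by (intro eventually_at_in_open') auto
    \<comment> \<open>The argument of \<open>g\<close> is shifted so that it equals \<open>x\<close>
      at \<open>t = 0\<close>: the derivative of \<open>g\<close> is given at \<open>x\<close>,
      which need not lie in the range of \<open>P\<close>.\<close>
    ultimately have ev: "\<forall>\<^sub>F t in at 0. p + P *v (\<gamma> t - p) + g (x + (P *v (\<gamma> t - p) - P *v x)) = \<gamma> t"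
    proof eventually_elim
      case (elim t)
      then have "\<gamma> t \<in> M" using \<gamma>(2) by blast
      then have "\<gamma> t - p = P *v (\<gamma> t - p) + g (P *v (\<gamma> t - p))"
        using MW elim by blast
      moreover have "g (x + (P *v (\<gamma> t - p) - P *v x)) = g (P *v (\<gamma> t - p))"
        by (subst gP[symmetric]) (simp add: matrix_vector_right_distrib PP matrix_vector_mult_diff_distrib)
      ultimately show ?case by (simp add: algebra_simps)
    qed
    have P0: "P *v (\<gamma> 0 - p) = P *v x"
      by (simp add: \<gamma>(3) matrix_vector_right_distrib PP Pg)
    have 0: "((\<lambda>t. P *v (\<gamma> t - p)) has_derivative (\<lambda>t. P *v (t *\<^sub>R v - 0))) (at 0)"
      by (intro blmul has_derivative_diff d\<gamma> has_derivative_const)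
    then have 1: "((\<lambda>t. x + (P *v (\<gamma> t - p) - P *v x)) has_derivative (\<lambda>t. 0 + (P *v (t *\<^sub>R v - 0) - 0))) (at 0)"
      by (intro has_derivative_add has_derivative_diff has_derivative_const)
    have 2: "(g has_derivative (*v) G) (at (x + (P *v (\<gamma> 0 - p) - P *v x)))" using G by (simp add: P0)
    have "((\<lambda>t. g (x + (P *v (\<gamma> t - p) - P *v x))) has_derivative (\<lambda>t. G *v (0 + (P *v (t *\<^sub>R v - 0) - 0)))) (at 0)"
      by (rule has_derivative_compose[OF 1 2])
    then have H: "((\<lambda>t. p + P *v (\<gamma> t - p) + g (x + (P *v (\<gamma> t - p) - P *v x))) has_derivative
        (\<lambda>t. 0 + P *v (t *\<^sub>R v - 0) + G *v (0 + (P *v (t *\<^sub>R v - 0) - 0)))) (at 0)"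
      by (intro has_derivative_add has_derivative_const 0)
    have "p + P *v (\<gamma> 0 - p) + g (x + (P *v (\<gamma> 0 - p) - P *v x)) = \<gamma> 0"
      unfolding P0 by (simp add: \<gamma>(3))
    then have "(\<gamma> has_derivative (\<lambda>t. 0 + P *v (t *\<^sub>R v - 0) + G *v (0 + (P *v (t *\<^sub>R v - 0) - 0)))) (at 0)"
      by (rule has_derivative_transform_eventually[OF H ev]) simp_all
    then have "(\<lambda>t. t *\<^sub>R v) = (\<lambda>t. 0 + P *v (t *\<^sub>R v - 0) + G *v (0 + (P *v (t *\<^sub>R v - 0) - 0)))"
      by (rule has_derivative_unique[OF d\<gamma>])
    from fun_cong[OF this, of 1] have "v = P *v (P *v v) + G *v (P *v v)"
      by (simp add: PP)
    then show "v \<in> range (\<lambda>X. P *v X + G *v X)" by blast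
  qed
qed

section \<open>The tangential part of the helix direction is constant\<close>

text \<open>The component of \<open>d\<close> along \<open>M\<close> as a function of the point. The
  choice is unique wherever the tangent space is a linear subspace.\<close>

definition tangential_part :: "(complex^'n) set \<Rightarrow> complex^'n \<Rightarrow> complex^'n \<Rightarrow> complex^'n"
  where "tangential_part M d z =
    (SOME u. u \<in> tangent_space M z \<and> (\<forall>v\<in>tangent_space M z. orthogonal (d - u) v))"

text \<open>Uniqueness of the orthogonal component identifies the chosen vector with the witness
  inside \<open>has_angle\<close>, so its norm is known. As the tangent space is a complex subspace,
  orthogonality holds in the Hermitian sense.\<close>

lemma helix_tangential_part:
  assumes helix: "helix M \<theta> d" and z: "z \<in> M" and T: "tangent_space M z = range ((*v) A)"
  shows "tangential_part M d z \<in> tangent_space M z"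
    and "cinner (d - tangential_part M d z) (A *v X) = 0"
    and "norm (tangential_part M d z) = norm d * cos \<theta>"
    and "u \<in> tangent_space M z \<Longrightarrow> (\<And>X. cinner (d - u) (A *v X) = 0) \<Longrightarrow> tangential_part M d z = u"
proof -
  define t where "t = tangential_part M d z"
  obtain u w where uw: "d = u + w" "u \<in> tangent_space M z" "\<forall>v\<in>tangent_space M z. orthogonal w v"
    "norm u = norm d * cos \<theta>"
    using helix z unfolding helix_def has_angle_def by blast
  have t: "t \<in> tangent_space M z \<and> (\<forall>v\<in>tangent_space M z. orthogonal (d - t) v)"
    unfolding t_def tangential_part_def
    by (rule someI[of _ u]) (use uw in auto)
  have uniq: "a = b" if "a \<in> tangent_space M z" "\<forall>v\<in>tangent_space M z. orthogonal (d - a) v"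
    "b \<in> tangent_space M z" "\<forall>v\<in>tangent_space M z. orthogonal (d - b) v" for a b
  proof -
    have "a \<in> range ((*v) A)" "b \<in> range ((*v) A)" using that T by simp_all
    then obtain X Y where "a = A *v X" "b = A *v Y" by blast
    then have "a - b = A *v (X - Y)"
      by (simp add: matrix_vector_mult_diff_distrib)
    then have "a - b \<in> tangent_space M z" by (simp add: T)
    then have "(d - b) \<bullet> (a - b) - (d - a) \<bullet> (a - b) = 0"
      using that by (simp add: orthogonal_def)
    then have "(a - b) \<bullet> (a - b) = 0"
      by (simp add: algebra_simps)
    then show ?thesis by simp
  qed
  have sub: "vec.subspace (range ((*v) A))"
    using vec_subspace_matrix_image[OF vec.subspace_UNIV] .
  show "tangential_part M d z \<in> tangent_space M z"
    using t by (simp add: t_def)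
  show "cinner (d - tangential_part M d z) (A *v X) = 0" for X
  proof -
    have "orthogonal (d - t) v" if "v \<in> range ((*v) A)" for v
      using t T that by auto
    from cinner_eq_0_if_orthogonal[OF sub this rangeI[of _ X]] show ?thesis
      by (simp add: t_def)
  qed
  have "t = u"
    using uniq[of t u] t uw by simp
  then show "norm (tangential_part M d z) = norm d * cos \<theta>"
    using uw by (simp add: t_def)
  show "tangential_part M d z = u" if "u \<in> tangent_space M z" "\<And>X. cinner (d - u) (A *v X) = 0" for u
  proof -
    have "orthogonal (d - u) v" if v: "v \<in> tangent_space M z" for v
    proof -
      obtain X where "v = A *v X" using v T by auto
      then have "cinner (d - u) v = 0" using \<open>\<And>X. cinner (d - u) (A *v X) = 0\<close> by simp
      then show ?thesis using Re_cinner[of "d - u" v] by (simp add: orthogonal_def)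
    qed
    then show ?thesis using uniq[of t u] t that by (simp add: t_def)
  qed
qed

lemma graph_chart_in:
  assumes "graph_chart M p P \<rho> g W" "x \<in> ball 0 \<rho>"
  shows "p + P *v x + g x \<in> M"
proof -
  have W: "p + P *v x + g x \<in> W"
    using assms unfolding graph_chart_def by blast
  have "P *v (p + P *v x + g x - p) = P *v x" "g (P *v x) = g x"
    using assms unfolding graph_chart_def 
    by (auto simp: matrix_vector_right_distrib matrix_vector_mul_assoc)
  then show "p + P *v x + g x \<in> M"
    using assms W unfolding graph_chart_def by (auto simp: algebra_simps)
qed

text \<open>In a graph chart, orthogonality of \<open>d - t x\<close> to the tangent space is the
  normal equation for \<open>u\<close>, and the fixed norm of \<open>t x\<close> is
  \<open>cinner u (b x) = \<kappa>\<close>, so \<open>helix_graph_rigidity\<close> applies. Then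
  \<open>t x\<close> is compared, without being solved for, with the tangent vector
  \<open>\<tau> + G x *v \<tau>\<close>, whose distance from \<open>\<tau>\<close> is of higher
  order since \<open>Q 0 X *v \<tau> = 0\<close>.\<close>

lemma helix_tangential_part_derivative:
  fixes M :: "(complex^'n) set"
  assumes chart: "graph_chart M p P \<rho> g W" and helix: "helix M \<theta> d"
  shows "((\<lambda>x. tangential_part M d (p + P *v x + g x)) has_derivative (\<lambda>_. 0)) (at 0)"
proof -
  from chart have P: "P ** P = P" "conjugate_transpose P = P" and \<rho>: "\<rho> > 0"
    and holg: "holomorphic_map_on g (ball 0 \<rho>)" and g0: "g 0 = 0" "(g has_derivative (\<lambda>x. 0)) (at 0)"
    unfolding graph_chart_def by auto
  have PP: "P *v (P *v x) = P *v x" for x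
    using P by (simp add: matrix_vector_mul_assoc)
  obtain G where G: "\<And>x. x \<in> ball 0 \<rho> \<Longrightarrow> (g has_derivative (*v) (G x)) (at x)"
    using holomorphic_map_onE[OF holg open_ball] by blast
  obtain Q where Q: "\<And>x i j. x \<in> ball 0 \<rho> \<Longrightarrow> ((\<lambda>x. G x $ i $ j) has_derivative (\<lambda>X. Q x X $ i $ j)) (at x)"
    and Qs: "\<And>x c X. x \<in> ball 0 \<rho> \<Longrightarrow> Q x (c *s X) = (\<chi> i j. c * Q x X $ i $ j)"
    and sym: "\<And>x X Y. x \<in> ball 0 \<rho> \<Longrightarrow> Q x X *v Y = Q x Y *v X"
    by (rule jacobian_regular[OF open_ball]) (erule G, rule that)
  have z0: "0 \<in> ball 0 \<rho>" using \<rho> by simp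
  have "(*v) (G 0) = (\<lambda>x. 0)"
    using has_derivative_unique[OF G[OF z0] g0(2)] .
  then have G0: "G 0 = 0"
    by (simp add: matrix_eq fun_eq_iff)
  define \<tau> where "\<tau> = P *v d"
  define \<xi> where "\<xi> = d - P *v d"
  define t where "t x = tangential_part M d (p + P *v x + g x)" for x
  have P\<tau>: "P *v \<tau> = \<tau>" and P\<xi>: "P *v \<xi> = 0" and d: "d = \<tau> + \<xi>"
    by (simp_all add: \<tau>_def \<xi>_def PP matrix_vector_mult_diff_distrib)
  have cP: "cinner (P *v x) y = cinner x (P *v y)" for x y
    by (rule cinner_self_adjoint[OF P(2)])
  have inM: "p + P *v x + g x \<in> M" if "x \<in> ball 0 \<rho>" for x
    using graph_chart_in[OF chart that] .
  have T: "tangent_space M (p + P *v x + g x) = range ((*v) (P + G x))"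
    and GP: "G x *v (P *v X) = G x *v X" and PG: "P *v (G x *v X) = 0" if "x \<in> ball 0 \<rho>" for x X
    using graph_chart_tangent_space[OF chart that G[OF that]]
    by (simp_all add: matrix_vector_mult_add_rdistrib[abs_def] matrix_vector_mul_assoc)
  note tang = helix_tangential_part[OF helix inM T, folded t_def]
  define \<kappa> :: complex where "\<kappa> = of_real ((norm d * cos \<theta>)\<^sup>2)"
  define b where "b x = \<tau> + conjugate_transpose (G x) *v \<xi>" for x
  have diag: "\<exists>u. u + conjugate_transpose (G x) *v (G x *v u) = b x \<and> cinner u (b x) = \<kappa>"
    if x: "x \<in> ball 0 \<rho>" for x
  proof -
    obtain X where X: "t x = (P + G x) *v X"
      using tang(1)[OF x x] T[OF x] by auto
    define u where "u = P *v X"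
    have tu: "t x = u + G x *v u" "P *v u = u"
      using X by (simp_all add: u_def GP[OF x] PP matrix_vector_mult_add_rdistrib)
    have "u + conjugate_transpose (G x) *v (G x *v u) = b x"
    proof (rule eq_if_cinner_eq)
      fix Z
      have "cinner (d - t x) ((P + G x) *v Z) = 0"
        using tang(2)[OF x x] .
      then have "cinner ((P + G x) *v Z) (d - t x) = 0"
        using cinner_eq_0_commute by blast
      moreover have "cinner (P *v Z) (d - t x) = cinner Z (\<tau> - u)"
        by (simp add: cP d tu matrix_vector_mult_diff_distrib matrix_vector_right_distrib P\<tau> P\<xi> PG[OF x])
      moreover have "cinner (G x *v Z) (d - t x) = cinner (G x *v Z) (\<xi> - G x *v u)"
      proof -
        have "cinner (G x *v Z) y = 0" if "P *v y = y" for y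
          using cP[of "G x *v Z" y] that by (simp add: PG[OF x])
        from this[OF P\<tau>] this[OF tu(2)] show ?thesis
          by (simp add: d tu cinner_simps)
      qed
      ultimately have "cinner Z (\<tau> - u) + cinner (G x *v Z) (\<xi> - G x *v u) = 0"
        by (simp add: matrix_vector_mult_add_rdistrib cinner_add_left)
      then show "cinner Z (u + conjugate_transpose (G x) *v (G x *v u)) = cinner Z (b x)"
        by (simp add: b_def cinner_simps cinner_adjoint algebra_simps)
    qed
    moreover have "cinner u (b x) = \<kappa>"
    proof -
      have "cinner (d - t x) (t x) = 0"
        using tang(2)[OF x x, of X] X by simp
      then have "cinner (t x) (d - t x) = 0"
        using cinner_eq_0_commute by blast
      then have "cinner (t x) d = cinner (t x) (t x)"
        by (simp add: cinner_diff_right)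
      also have "\<dots> = \<kappa>"
        using tang(3)[OF x x] by (simp add: cinner_self \<kappa>_def)
      finally have "cinner u d + cinner (G x *v u) d = \<kappa>"
        by (simp add: tu cinner_add_left)
      moreover have "cinner u d = cinner u \<tau>"
        using cP[of u d] by (simp add: tu \<tau>_def)
      moreover have "cinner (G x *v u) d = cinner (G x *v u) \<xi>"
        using cP[of "G x *v u" d] by (simp add: \<xi>_def PG[OF x] cinner_diff_right)
      ultimately show ?thesis
        by (simp add: b_def cinner_add_right cinner_adjoint)
    qed
    ultimately show ?thesis by blast
  qed
  have hol: "(\<lambda>l. G (m + l *s k) $ i $ j) holomorphic_on {l. m + l *s k \<in> ball 0 \<rho>}" for m k i j
    by (rule holomorphic_along_line[where D = "\<lambda>x X. Q x X $ i $ j", OF Q _ open_ball]) (simp_all add: Qs)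
  have dQ: "((\<lambda>l. G (l *s X) $ i $ j) has_field_derivative Q 0 X $ i $ j) (at 0)" for X i j
    using has_field_derivative_along_line[of "\<lambda>x. G x $ i $ j" "\<lambda>X. Q 0 X $ i $ j" 0 0 X] Q[OF z0] Qs[OF z0]
    by simp
  have Q\<tau>: "Q 0 X *v \<tau> = 0" for X
    using helix_graph_rigidity(1)[OF hol b_def diag dQ sym[OF z0] G0 \<rho>] by simp
  have G\<tau>\<xi>: "cinner (G x *v \<tau>) \<xi> = 0" if "x \<in> ball 0 \<rho>" for x
    using helix_graph_rigidity(2)[OF hol b_def diag dQ sym[OF z0] G0 \<rho>] that by simp
  have t0: "t 0 = \<tau>"
  proof (rule tang(4)[OF z0 z0])
    show "\<tau> \<in> tangent_space M (p + P *v 0 + g 0)"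
      unfolding T[OF z0] G0 using rangeI[of "(*v) (P + 0)" d] by (simp add: \<tau>_def)
    show "cinner (d - \<tau>) ((P + G 0) *v X) = 0" for X
      using cP[of "d - \<tau>" X] by (simp add: G0 d P\<xi>)
  qed
  have n\<tau>: "norm (t x) = norm \<tau>" if "x \<in> ball 0 \<rho>" for x
    using tang(3)[OF that that] tang(3)[OF z0 z0] t0 by simp
  \<comment> \<open>As \<open>s\<close> is tangent, \<open>cinner (t x) s = cinner d s\<close>, and
    this is \<open>cinner \<tau> \<tau>\<close> because \<open>G x *v \<tau>\<close> is orthogonal
    to both \<open>\<tau>\<close> and \<open>\<xi>\<close>. Since \<open>t x\<close> and
    \<open>\<tau>\<close> have equal norm, expanding the square gives
    \<open>norm (t x - s) = norm (G x *v \<tau>)\<close>; the same length separates \<open>s\<close>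
    from \<open>\<tau>\<close>, hence the factor 2.\<close>
  have bound: "norm (t x - \<tau>) \<le> 2 * norm (G x *v \<tau>)" if x: "x \<in> ball 0 \<rho>" for x
  proof -
    define s where "s = \<tau> + G x *v \<tau>"
    have \<tau>G: "cinner \<tau> (G x *v \<tau>) = 0"
      using cP[of \<tau> "G x *v \<tau>"] by (simp add: P\<tau> PG[OF x])
    have "cinner (d - t x) s = 0"
      using tang(2)[OF x x, of \<tau>] by (simp add: s_def matrix_vector_mult_add_rdistrib P\<tau>)
    then have "cinner (t x) s = cinner d s"
      by (simp add: cinner_diff_left)
    also have "\<dots> = cinner \<tau> \<tau>"
    proof -
      have "cinner \<xi> (G x *v \<tau>) = 0" using G\<tau>\<xi>[OF x] cinner_eq_0_commute by blast
      moreover have "cinner \<xi> \<tau> = 0" using cP[of \<xi> \<tau>] by (simp add: P\<tau> P\<xi>)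
      ultimately show ?thesis
        using \<tau>G by (simp add: d s_def cinner_simps)
    qed
    finally have ts: "t x \<bullet> s = norm \<tau> ^ 2"
      using Re_cinner[of "t x" s] by (simp add: cinner_self)
    have "\<tau> \<bullet> (G x *v \<tau>) = 0"
      using \<tau>G Re_cinner[of \<tau> "G x *v \<tau>"] by simp
    then have "norm s ^ 2 = norm \<tau> ^ 2 + norm (G x *v \<tau>) ^ 2"
      unfolding s_def by (intro norm_add_Pythagorean) (simp add: orthogonal_def)
    moreover have "norm (t x - s) ^ 2 = norm (t x) ^ 2 - 2 * (t x \<bullet> s) + norm s ^ 2"
      by (simp add: power2_norm_eq_inner inner_diff inner_commute)
    ultimately have "norm (t x - s) ^ 2 = norm (G x *v \<tau>) ^ 2"
      using n\<tau>[OF x] ts by simp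
    then have "norm (t x - s) = norm (G x *v \<tau>)"
      by (simp add: power2_eq_iff_nonneg)
    then show ?thesis
      using norm_triangle_ineq[of "t x - s" "G x *v \<tau>"] by (simp add: s_def)
  qed
  have "((\<lambda>x. G x *v \<tau>) has_derivative (\<lambda>X. Q 0 X *v \<tau>)) (at 0)"
  proof (rule has_derivative_vecI)
    fix i
    have "((\<lambda>x. \<Sum>j\<in>UNIV. G x $ i $ j * \<tau> $ j) has_derivative (\<lambda>X. \<Sum>j\<in>UNIV. Q 0 X $ i $ j * \<tau> $ j)) (at 0)"
      by (intro has_derivative_sum has_derivative_mult_left Q z0)
    then show "((\<lambda>x. (G x *v \<tau>) $ i) has_derivative (\<lambda>X. (Q 0 X *v \<tau>) $ i)) (at 0)"
      by (simp add: matrix_vector_mult_def)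
  qed
  then have "((\<lambda>x. G x *v \<tau>) has_derivative (\<lambda>X. 0)) (at 0)"
    by (simp add: Q\<tau>)
  then have lim: "((\<lambda>y. norm (G y *v \<tau>) / norm y) \<longlongrightarrow> 0) (at 0)"
    by (simp add: has_derivative_iff_norm G0)
  have "(t has_derivative (\<lambda>_. 0)) (at 0)"
  proof (rule has_derivativeI_sandwich[OF \<rho> bounded_linear_zero])
    show "((\<lambda>y. 2 * (norm (G y *v \<tau>) / norm y)) \<longlongrightarrow> 0) (at 0)"
      using tendsto_mult_right_zero[OF lim] .
    show "norm (t y - t 0 - 0) / norm (y - 0) \<le> 2 * (norm (G y *v \<tau>) / norm y)"
      if "y \<noteq> 0" "dist y 0 < \<rho>" for y
      using divide_right_mono[OF bound[of y] norm_ge_zero[of y]] that by (simp add: t0)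
  qed
  then show ?thesis by (simp add: t_def[abs_def])
qed

section \<open>From a single chart to the connected submanifold\<close>

lemma graph_chart_embedding_derivative:
  assumes chart: "graph_chart M p P \<rho> g W" and x: "x \<in> ball 0 \<rho>"
  obtains G where "(g has_derivative (*v) G) (at x)"
    "((\<lambda>x. p + P *v x + g x) has_derivative (*v) (P + G)) (at x)"
    "tangent_space M (p + P *v x + g x) = range ((*v) (P + G))"
proof -
  have "holomorphic_map_on g (ball 0 \<rho>)" using chart by (simp add: graph_chart_def)
  then obtain G where "\<And>x. x \<in> ball 0 \<rho> \<Longrightarrow> (g has_derivative (*v) (G x)) (at x)"
    using holomorphic_map_onE[OF _ open_ball] by blast
  then have G: "(g has_derivative (*v) (G x)) (at x)" using x by blast
  have "((\<lambda>x. p + P *v x + g x) has_derivative (\<lambda>X. 0 + P *v X + G x *v X)) (at x)"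
    by (intro has_derivative_add has_derivative_const G
        bounded_linear.has_derivative[OF matrix_vector_mul_bounded_linear] has_derivative_ident)
  then have "((\<lambda>x. p + P *v x + g x) has_derivative (*v) (P + G x)) (at x)"
    by (simp add: matrix_vector_mult_add_rdistrib[abs_def])
  then show ?thesis
    using that[OF G] graph_chart_tangent_space(1)[OF chart x G]
    by (simp add: matrix_vector_mult_add_rdistrib[abs_def])
qed

text \<open>A chart covers the neighbourhood \<open>M \<inter> W\<close> by a ball, on which a
  vanishing derivative means constancy; connectedness turns local constancy into global.\<close>

lemma constant_on_submanifold:
  fixes M :: "(complex^'n) set" and f :: "complex^'n \<Rightarrow> 'b::real_normed_vector"
  assumes M: "complex_submanifold UNIV m M" and conn: "connected M"
    and zero: "\<And>p P \<rho> g W x. graph_chart M p P \<rho> g W \<Longrightarrow> x \<in> ball 0 \<rho> \<Longrightarrow>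
        ((\<lambda>x. f (p + P *v x + g x)) has_derivative (\<lambda>_. 0)) (at x)"
  shows "f constant_on M"
proof (rule locally_constant_imp_constant[OF conn])
  fix a assume a: "a \<in> M"
  obtain P \<rho> g W where chart: "graph_chart M a P \<rho> g W"
    by (rule complex_submanifold_graph_chart[OF M a]) (rule that)
  define h where "h x = f (a + P *v x + g x)" for x
  have "(h has_derivative (\<lambda>_. 0)) (at x within ball 0 \<rho>)" if "x \<in> ball 0 \<rho>" for x
    using zero[OF chart that] by (simp add: h_def[abs_def] has_derivative_at_withinI)
  then have "\<exists>c. \<forall>x\<in>ball 0 \<rho>. h x = c"
    by (rule has_derivative_zero_constant[OF convex_ball])
  then obtain c where c: "\<And>x. x \<in> ball 0 \<rho> \<Longrightarrow> h x = c"
    by blast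
  from chart have W: "open W" "a \<in> W" and PP: "P ** P = P"
    and Wb: "\<And>z. z \<in> W \<Longrightarrow> norm (P *v (z - a)) < \<rho>"
    and WM: "\<And>z. z \<in> W \<Longrightarrow> z \<in> M \<longleftrightarrow> z - a = P *v (z - a) + g (P *v (z - a))"
    unfolding graph_chart_def by auto
  have "f z = c" if "z \<in> M \<inter> W" for z
  proof -
    define y where "y = P *v (z - a)"
    have "z - a = y + g y" "P *v y = y"
      using WM[of z] that by (simp_all add: y_def matrix_vector_mul_assoc PP)
    then have "h y = f z"
      by (simp add: h_def algebra_simps)
    then show ?thesis using c[of y] Wb[of z] that by (simp add: y_def)
  qed
  moreover have "openin (top_of_set M) (M \<inter> W)"
    using W by (simp add: openin_open_Int)
  ultimately show "\<exists>T. openin (top_of_set M) T \<and> a \<in> T \<and> (\<forall>x\<in>T. f x = f a)"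
    using W a by (intro exI[of _ "M \<inter> W"]) auto
qed

text \<open>The vanishing derivative is known only at the centre of a chart. For another parameter
  \<open>x\<close> a second chart is centred at \<open>Z x\<close>, and the transition map
  \<open>y\<close>, which sends \<open>x\<close> to 0, transports the statement by the chain
  rule.\<close>

lemma helix_tangential_part_constant:
  fixes M :: "(complex^'n) set"
  assumes M: "complex_submanifold UNIV m M" and conn: "connected M" and helix: "helix M \<theta> d"
  shows "tangential_part M d constant_on M"
proof (rule constant_on_submanifold[OF M conn])
  fix p P \<rho> g W and x :: "complex^'n"
  assume chart: "graph_chart M p P \<rho> g W" and x: "x \<in> ball 0 \<rho>"
  define Z where "Z x = p + P *v x + g x" for x
  have Zx: "Z x \<in> M" using graph_chart_in[OF chart x] by (simp add: Z_def)
  obtain P' \<rho>' g' W' where chart': "graph_chart M (Z x) P' \<rho>' g' W'"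
    by (rule complex_submanifold_graph_chart[OF M Zx]) (rule that)
  from chart' have W': "open W'" "Z x \<in> W'" and PP': "P' ** P' = P'"
    and WM': "\<And>z. z \<in> W' \<Longrightarrow> z \<in> M \<longleftrightarrow> z - Z x = P' *v (z - Z x) + g' (P' *v (z - Z x))"
    unfolding graph_chart_def by auto
  obtain G where "((\<lambda>x. p + P *v x + g x) has_derivative (*v) (P + G)) (at x)"
    by (rule graph_chart_embedding_derivative[OF chart x]) (rule that)
  then have G: "(Z has_derivative (*v) (P + G)) (at x)"
    by (simp add: Z_def[abs_def])
  define y where "y w = P' *v (Z w - Z x)" for w
  have y: "(y has_derivative (\<lambda>X. P' *v ((P + G) *v X - 0))) (at x)"
    unfolding y_def by (intro bounded_linear.has_derivative[OF matrix_vector_mul_bounded_linear]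
        has_derivative_diff G has_derivative_const)
  have "((\<lambda>v. tangential_part M d (Z x + P' *v v + g' v)) has_derivative (\<lambda>_. 0)) (at (y x))"
    using helix_tangential_part_derivative[OF chart' helix] by (simp add: y_def)
  from has_derivative_compose[OF y this]
  have H: "((\<lambda>w. tangential_part M d (Z x + P' *v (y w) + g' (y w))) has_derivative (\<lambda>_. 0)) (at x)" .
  have "\<forall>\<^sub>F w in at x. Z w \<in> W'"
    using has_derivative_continuous[OF G] W' unfolding continuous_at by (rule topological_tendstoD)
  moreover have "\<forall>\<^sub>F w in at x. w \<in> ball 0 \<rho>"
    using x by (intro eventually_at_in_open') auto
  ultimately have "\<forall>\<^sub>F w in at x. tangential_part M d (Z x + P' *v (y w) + g' (y w)) = tangential_part M d (Z w)"
  proof eventually_elim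
    case (elim w)
    have "Z w \<in> M" using graph_chart_in[OF chart elim(2)] by (simp add: Z_def)
    then have "Z w - Z x = y w + g' (y w)" using WM'[OF elim(1)] by (simp add: y_def)
    moreover have "P' *v y w = y w" by (simp add: y_def matrix_vector_mul_assoc PP')
    ultimately show ?case by (simp add: algebra_simps)
  qed
  moreover have "tangential_part M d (Z x + P' *v (y x) + g' (y x)) = tangential_part M d (Z x)"
    using chart' by (simp add: y_def graph_chart_def)
  ultimately show "((\<lambda>x. tangential_part M d (p + P *v x + g x)) has_derivative (\<lambda>_. 0)) (at x)"
    unfolding Z_def[symmetric] by (intro has_derivative_transform_eventually[OF H]) auto
qed

text \<open>The normal part \<open>\<xi>\<close> is constant and orthogonal to every tangent space,
  so \<open>\<xi> \<bullet> z\<close> is constant on \<open>M\<close>; unless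
  \<open>\<xi> = 0\<close>, this puts \<open>M\<close> into a hyperplane.\<close>

lemma full_helix_direction_tangent:
  fixes M :: "(complex^'n) set"
  assumes M: "complex_submanifold UNIV m M" and conn: "connected M" and helix: "helix M \<theta> d"
    and full: "full M"
  shows "\<And>z. z \<in> M \<Longrightarrow> d \<in> tangent_space M z" and "d \<noteq> 0 \<Longrightarrow> \<theta> = 0"
proof -
  \<comment> \<open>The angle is read off at a point of \<open>M\<close>; fullness provides one, as
    the empty set lies in every hyperplane.\<close>
  have "M \<noteq> {}"
  proof
    assume "M = {}"
    moreover have "(axis undefined 1 :: complex^'n) \<noteq> 0" by (simp add: axis_eq_0_iff)
    ultimately show False using full unfolding full_def by blast
  qed
  obtain t where t: "\<And>z. z \<in> M \<Longrightarrow> tangential_part M d z = t"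
    using helix_tangential_part_constant[OF M conn helix] unfolding constant_on_def by blast
  define \<xi> where "\<xi> = d - t"
  have tan: "\<exists>A :: complex^'n^'n. tangent_space M z = range ((*v) A)" if z: "z \<in> M" for z
  proof -
    obtain P \<rho> g W where chart: "graph_chart M z P \<rho> g W"
      by (rule complex_submanifold_graph_chart[OF M z]) (rule that)
    then have 0: "0 \<in> ball 0 \<rho>" "g 0 = 0" by (auto simp: graph_chart_def)
    obtain G where "tangent_space M (z + P *v 0 + g 0) = range ((*v) (P + G))"
      by (rule graph_chart_embedding_derivative[OF chart 0(1)]) (rule that)
    then have "tangent_space M z = range ((*v) (P + G))" using 0 by simp
    then show ?thesis by blast
  qed
  have "(\<lambda>z. \<xi> \<bullet> z) constant_on M"
  proof (rule constant_on_submanifold[OF M conn])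
    fix p P \<rho> g W and x :: "complex^'n"
    assume chart: "graph_chart M p P \<rho> g W" and x: "x \<in> ball 0 \<rho>"
    obtain G where G: "((\<lambda>x. p + P *v x + g x) has_derivative (*v) (P + G)) (at x)"
      and T: "tangent_space M (p + P *v x + g x) = range ((*v) (P + G))"
      by (rule graph_chart_embedding_derivative[OF chart x]) (rule that)
    have z: "p + P *v x + g x \<in> M" using graph_chart_in[OF chart x] by simp
    have "\<xi> \<bullet> ((P + G) *v X) = 0" for X
      using helix_tangential_part(2)[OF helix z T, of X] Re_cinner[of \<xi> "(P + G) *v X"]
      by (simp add: t[OF z] \<xi>_def)
    moreover have "((\<lambda>x. \<xi> \<bullet> (p + P *v x + g x)) has_derivative (\<lambda>X. \<xi> \<bullet> ((P + G) *v X))) (at x)"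
      by (intro has_derivative_inner_right G)
    ultimately show "((\<lambda>x. \<xi> \<bullet> (p + P *v x + g x)) has_derivative (\<lambda>_. 0)) (at x)"
      by simp
  qed
  then obtain c where "\<And>z. z \<in> M \<Longrightarrow> \<xi> \<bullet> z = c"
    unfolding constant_on_def by blast
  then have "\<xi> = 0"
    using full unfolding full_def by blast
  then have td: "t = d" by (simp add: \<xi>_def)
  show "d \<in> tangent_space M z" if z: "z \<in> M" for z
  proof -
    obtain A :: "complex^'n^'n" where "tangent_space M z = range ((*v) A)" using tan[OF z] by blast
    from helix_tangential_part(1)[OF helix z this] show ?thesis
      by (simp add: t[OF z] td)
  qed
  show "\<theta> = 0" if "d \<noteq> 0"
  proof -
    obtain z where z: "z \<in> M" using \<open>M \<noteq> {}\<close> by blast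
    obtain A :: "complex^'n^'n" where "tangent_space M z = range ((*v) A)" using tan[OF z] by blast
    from helix_tangential_part(3)[OF helix z this] have "norm d = norm d * cos \<theta>"
      by (simp add: t[OF z] td)
    then have "cos \<theta> = 1" using that by simp
    moreover have "0 \<le> \<theta>" "\<theta> \<le> pi"
      using helix z pi_gt_zero unfolding helix_def has_angle_def by force+
    ultimately show ?thesis
      using cos_inj_pi[of \<theta> 0] by simp
  qed
qed

section \<open>The extrinsic product\<close>

lemma cinner_axis: "cinner x (axis i 1) = x $ i"
proof -
  have "x $ j * cnj (axis i 1 $ j) = (if j = i then x $ i else 0)" for j
    by (simp add: axis_def)
  then show ?thesis
    by (simp add: cinner_def)
qed

text \<open>With the phase of \<open>\<alpha>\<close> opposite to that of \<open>d $ i\<close>, the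
  number \<open>cinner d v\<close> is a positive real \<open>K\<close> and
  \<open>cinner v v = 2 * K\<close>. Thus \<open>A\<close> is the reflection in the complex
  hyperplane orthogonal to \<open>v\<close>, and it sends \<open>d\<close> to
  \<open>d - v\<close>.\<close>

lemma Householder_reflection:
  fixes d :: "complex^'n"
  assumes d: "d \<noteq> 0"
  obtains A i \<alpha> where "unitary A" "\<alpha> \<noteq> 0" "A *v d = \<alpha> *s axis i 1"
proof -
  obtain i where i: "d $ i \<noteq> 0" using d by (auto simp: vec_eq_iff)
  define \<alpha> where "\<alpha> = - (d $ i / of_real (norm (d $ i))) * of_real (norm d)"
  define K where "K = norm d ^ 2 + norm (d $ i) * norm d"
  have K: "K > 0" using d i by (simp add: K_def add_pos_pos)
  define v where "v = d - \<alpha> *s axis i 1"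
  define A :: "complex^'n^'n" where "A = (\<chi> r c. (if r = c then 1 else 0) - v $ r * cnj (v $ c) / of_real K)"
  have "\<alpha> \<noteq> 0" using d i by (simp add: \<alpha>_def)
  have "cnj (d $ i) * d $ i = of_real (norm (d $ i)) * of_real (norm (d $ i))"
    using complex_norm_square[of "d $ i"] by (simp add: power2_eq_square mult.commute)
  moreover have "cnj \<alpha> * d $ i = - (cnj (d $ i) * d $ i) / of_real (norm (d $ i)) * of_real (norm d)"
    by (simp add: \<alpha>_def)
  ultimately have \<alpha>d: "cnj \<alpha> * d $ i = - of_real (norm (d $ i) * norm d)"
    using i by simp
  have "norm \<alpha> = norm d"
    using i by (simp add: \<alpha>_def norm_mult norm_divide)
  then have \<alpha>\<alpha>: "\<alpha> * cnj \<alpha> = of_real (norm d ^ 2)"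
    by (simp only: complex_norm_square[symmetric])
  have dv: "cinner d v = of_real K"
    by (simp add: v_def cinner_diff_right cinner_scale_right cinner_axis cinner_self \<alpha>d K_def)
  have ev: "cinner (axis i 1) v = cnj (d $ i) - cnj \<alpha>"
    unfolding v_def cinner_diff_right cinner_scale_right cinner_axis
    using cinner_commute[of d "axis i 1"] by (simp add: cinner_axis)
  have "\<alpha> * cinner (axis i 1) v = cnj (cnj \<alpha> * d $ i) - \<alpha> * cnj \<alpha>"
    unfolding ev by (simp add: algebra_simps)
  also have "\<dots> = - of_real K"
    by (simp only: \<alpha>d \<alpha>\<alpha>) (simp add: K_def)
  finally have "\<alpha> * cinner (axis i 1) v = - of_real K" .
  moreover have "cinner v v = cinner d v - \<alpha> * cinner (axis i 1) v"
    using cinner_diff_left[of d "\<alpha> *s axis i 1" v] by (simp only: cinner_scale_left flip: v_def)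
  ultimately have vv: "cinner v v = 2 * of_real K"
    using dv by simp
  have A: "A *v x = x - (cinner x v / of_real K) *s v" for x
  proof -
    have "(A *v x) $ r = (\<Sum>c\<in>UNIV. (if r = c then x $ c else 0) - v $ r * (x $ c * cnj (v $ c)) / of_real K)" for r
      unfolding A_def matrix_vector_mult_def vec_lambda_beta
      by (intro sum.cong) (auto simp: algebra_simps)
    also have "\<dots> r = x $ r - v $ r * cinner x v / of_real K" for r
      by (simp add: sum_subtractf cinner_def sum_distrib_left sum_divide_distrib)
    finally show ?thesis by (simp add: vec_eq_iff)
  qed
  have "A *v (A *v x) = x" for x
    using K by (simp add: A cinner_diff_left cinner_scale_left vv vec_eq_iff field_simps)
  then have "A ** A = mat 1"
    by (simp add: matrix_eq flip: matrix_vector_mul_assoc)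
  moreover have "conjugate_transpose A = A"
    by (auto simp: conjugate_transpose_def A_def vec_eq_iff)
  ultimately have "unitary A" by (simp add: unitary_def)
  moreover have "A *v d = \<alpha> *s axis i 1"
    using K by (simp add: A dv) (simp add: v_def)
  ultimately show ?thesis
    by (rule that[OF _ \<open>\<alpha> \<noteq> 0\<close>])
qed

text \<open>Writing \<open>d = P *v X + G *v X\<close> and projecting shows
  \<open>d = P *v d + G *v d\<close> at every point of the ball. At the centre the derivative of
  \<open>g\<close> is zero, so \<open>P *v d = d\<close>; elsewhere this forces
  \<open>G *v d = 0\<close>, and \<open>g\<close> is constant on segments in the direction of
  complex multiples of \<open>d\<close>.\<close>

lemma graph_chart_invariant:
  assumes chart: "graph_chart M p P \<rho> g W" and d: "\<And>z. z \<in> M \<Longrightarrow> d \<in> tangent_space M z"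
  shows "P *v d = d"
    and "x \<in> ball 0 \<rho> \<Longrightarrow> x + c *s d \<in> ball 0 \<rho> \<Longrightarrow> g (x + c *s d) = g x"
proof -
  have P: "P *v (P *v x) = P *v x" for x
    using chart unfolding graph_chart_def by (simp add: matrix_vector_mul_assoc)
  have der: "\<exists>G. (g has_derivative (*v) G) (at x) \<and> d = P *v d + G *v d" if x: "x \<in> ball 0 \<rho>" for x
  proof -
    obtain G where G: "(g has_derivative (*v) G) (at x)"
      by (rule graph_chart_embedding_derivative[OF chart x]) (rule that)
    note T = graph_chart_tangent_space[OF chart x G]
    have "d \<in> tangent_space M (p + P *v x + g x)"
      using d graph_chart_in[OF chart x] by blast
    then obtain X where X: "d = P *v X + G *v X"
      using T(1) by auto
    have GP: "G *v (P *v Y) = G *v Y" and PG: "P *v (G *v Y) = 0" for Y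
      using T(2,3) by (simp_all add: matrix_vector_mul_assoc)
    have "P *v d = P *v X"
      by (subst X) (simp add: matrix_vector_right_distrib P PG)
    then have "G *v d = G *v X"
      using GP[of d] GP[of X] by simp
    with \<open>P *v d = P *v X\<close> X have "d = P *v d + G *v d"
      by simp
    with G show ?thesis by (intro exI[of _ G] conjI)
  qed
  have \<rho>: "0 \<in> ball 0 \<rho>" and g0: "(g has_derivative (\<lambda>x. 0)) (at 0)"
    using chart by (auto simp: graph_chart_def)
  show Pd: "P *v d = d"
  proof -
    obtain G where G: "(g has_derivative (*v) G) (at 0)" "d = P *v d + G *v d"
      using der[OF \<rho>] by blast
    have "G *v d = 0"
      using fun_cong[OF has_derivative_unique[OF G(1) g0], of d] .
    with G(2) show ?thesis by simp
  qed
  show "g (x + c *s d) = g x" if x: "x \<in> ball 0 \<rho>" "x + c *s d \<in> ball 0 \<rho>"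
  proof -
    define h where "h s = g (x + s *\<^sub>R (c *s d))" for s :: real
    have "(h has_derivative (\<lambda>_. 0)) (at s within {0..1})" if s: "s \<in> {0..1}" for s
    proof -
      have "(1 - s) *\<^sub>R x + s *\<^sub>R (x + c *s d) \<in> ball 0 \<rho>"
        using convexD_alt[OF convex_ball x] s by auto
      then have "x + s *\<^sub>R (c *s d) \<in> ball 0 \<rho>"
        by (simp add: algebra_simps)
      then obtain G where G: "(g has_derivative (*v) G) (at (x + s *\<^sub>R (c *s d)))" "d = P *v d + G *v d"
        using der by blast
      have "((\<lambda>s. x + s *\<^sub>R (c *s d)) has_derivative (\<lambda>s. 0 + s *\<^sub>R (c *s d))) (at s)"
        by (intro has_derivative_add has_derivative_const has_derivative_scaleR_left has_derivative_ident)
      from has_derivative_compose[OF this G(1)]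
      have "(h has_derivative (\<lambda>s. G *v (0 + s *\<^sub>R (c *s d)))) (at s)"
        by (simp add: h_def[abs_def])
      moreover have "G *v d = 0" using G(2) Pd by simp
      ultimately have "(h has_derivative (\<lambda>_. 0)) (at s)"
        by (simp add: scaleR_eq_vector_scalar_mult vector_scalar_commute)
      then show ?thesis by (rule has_derivative_at_withinI)
    qed
    then have "h 1 = h 0"
      by (intro has_derivative_zero_unique[of "{0..1}" h 1 0] convex_real_interval) simp_all
    then show ?thesis by (simp add: h_def)
  qed
qed

text \<open>The factor is the graph of \<open>g\<close> over \<open>L0\<close>, the orthogonal
  complement of \<open>d\<close> in the range of \<open>P\<close>, translated by \<open>q\<close>
  and written in the coordinates \<open>A\<close>. Values of \<open>g\<close> are orthogonal to
  \<open>d\<close> because \<open>P *v d = d\<close>, so the graph stays in the hyperplane;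
  subtracting \<open>g\<close> straightens it.\<close>

lemma extrinsic_product_factor:
  fixes A P :: "complex^'n^'n"
  assumes chart: "graph_chart M p P \<rho> g W" and A: "unitary A" and Pd: "P *v d = d" and d: "d \<noteq> 0"
    and H: "\<And>v. (A *v v) $ i = 0 \<longleftrightarrow> cinner v d = 0" and q: "cinner q d = 0"
    and dim: "vec.dim (range ((*v) P)) = m"
  shows "complex_submanifold {w. w $ i = 0} (m - 1)
    ((*v) A ` {q + x + g x | x. x \<in> ball 0 \<rho> \<and> P *v x = x \<and> cinner x d = 0})"
    (is "complex_submanifold ?H _ ?N")
proof -
  from chart have P: "P ** P = P" "conjugate_transpose P = P"
    and hol: "holomorphic_map_on g (ball 0 \<rho>)" and Pg: "\<And>x. P *v g x = 0"
    unfolding graph_chart_def by auto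
  define B where "B = conjugate_transpose A"
  have AB: "A *v (B *v x) = x" and BA: "B *v (A *v x) = x" for x
    using A by (simp_all add: B_def unitary_def matrix_vector_mul_assoc)
  have PP: "P *v (P *v x) = P *v x" for x
    using P by (simp add: matrix_vector_mul_assoc)
  have HB: "w \<in> ?H \<longleftrightarrow> cinner (B *v w) d = 0" for w
    using H[of "B *v w"] by (simp add: AB)
  have gd: "cinner (g x) d = 0" for x
    using cinner_self_adjoint[OF P(2), of "g x" d] by (simp add: Pg Pd)
  define L0 where "L0 = {x. P *v x = x \<and> cinner x d = 0}"
  define L where "L = (*v) A ` L0"
  define U where "U = ?H \<inter> {w. norm (P *v (B *v w - q)) < \<rho>}"
  define V where "V = ?H \<inter> {w. norm (P *v (B *v w)) < \<rho>}"
  define F where "F w = A *v (B *v w - q - g (P *v (B *v w - q)))" for w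
  define G where "G w = A *v (q + B *v w + g (P *v (B *v w)))" for w
  have sH: "vec.subspace ?H"
    by (auto simp: vec.subspace_def)
  have sL0: "vec.subspace L0"
    by (auto simp: L0_def vec.subspace_def matrix_vector_right_distrib cinner_simps vector_scalar_commute)
  have inj: "inj_on ((*v) A) L0"
    by (rule inj_on_inverseI[where g = "(*v) B"]) (rule BA)
  have span_L0: "vec.span L0 = L0"
    using sL0 vec.span_eq_iff by blast
  have lin: "Vector_Spaces.linear (*s) (*s) ((*v) A)"
    by (rule matrix_vector_mul_linear_gen)
  have sL: "vec.subspace L"
    unfolding L_def by (rule vec_subspace_matrix_image[OF sL0])
  have LH: "L \<subseteq> ?H"
    using H by (auto simp: L_def L0_def)
  have dimL: "vec.dim L = m - 1"
  proof -
    have "vec.dim L = vec.dim L0"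
      unfolding L_def using vec.dim_image_eq[OF lin, of L0] inj by (simp add: span_L0)
    \<comment> \<open>\<open>L0\<close> and \<open>d\<close> span the range of \<open>P\<close>. In
      particular \<open>m\<close> is at least 1, so \<open>m - 1\<close> is not truncated.\<close>
    moreover have "m = vec.dim L0 + 1"
    proof -
      have "d \<notin> L0" using d by (simp add: L0_def)
      then have dim_insert: "vec.dim (insert d L0) = vec.dim L0 + 1"
        by (simp add: vec.dim_insert span_L0)
      have span_eq: "vec.span (insert d L0) = range ((*v) P)"
      proof (intro subset_antisym subsetI)
        fix y assume "y \<in> vec.span (insert d L0)"
        then obtain k where "y - k *s d \<in> L0"
          using vec.span_breakdown_eq[of y d L0] unfolding span_L0 by blast
        then have "P *v y = y"
          by (simp add: L0_def matrix_vector_mult_diff_distrib vector_scalar_commute Pd)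
        then show "y \<in> range ((*v) P)" by (metis rangeI)
      next
        fix y assume "y \<in> range ((*v) P)"
        then have y: "P *v y = y" using PP by auto
        have "y - (cinner y d / cinner d d) *s d \<in> L0"
          using d by (simp add: L0_def matrix_vector_mult_diff_distrib vector_scalar_commute Pd y cinner_simps)
        then show "y \<in> vec.span (insert d L0)"
          using vec.span_breakdown_eq[of y d L0] vec.span_base by blast
      qed
      have "m = vec.dim (vec.span (insert d L0))"
        by (simp only: span_eq dim)
      also have "\<dots> = vec.dim (insert d L0)"
        by (rule vec.dim_span)
      finally show ?thesis
        by (simp only: dim_insert)
    qed
    ultimately show ?thesis by simp
  qed
  have cont: "continuous_on UNIV (\<lambda>w. norm (P *v (B *v w - r)))" for r
    by (intro continuous_on_norm bounded_linear.continuous_on[OF matrix_vector_mul_bounded_linear] continuous_intros)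
  have opU: "openin (top_of_set ?H) U"
    unfolding U_def by (intro openin_open_Int open_Collect_less cont continuous_on_const)
  have opV: "openin (top_of_set ?H) V"
    using cont[of 0] unfolding V_def by (intro openin_open_Int open_Collect_less continuous_on_const) simp
  obtain D where D: "\<And>x. x \<in> ball 0 \<rho> \<Longrightarrow> (g has_derivative (*v) (D x)) (at x)"
    using holomorphic_map_onE[OF hol open_ball] by blast
  note blmul = bounded_linear.has_derivative[OF matrix_vector_mul_bounded_linear]
  have dF: "(F has_derivative (*v) (A ** (B - D (P *v (B *v w - q)) ** (P ** B)))) (at w)" if "w \<in> U" for w
  proof -
    have v: "((\<lambda>w. B *v w - q) has_derivative (\<lambda>h. B *v h - 0)) (at w)"
      by (intro has_derivative_diff blmul has_derivative_ident has_derivative_const)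
    have "P *v (B *v w - q) \<in> ball 0 \<rho>" using that by (simp add: U_def)
    from has_derivative_compose[OF blmul[OF v] D[OF this]] v
    have "(F has_derivative (\<lambda>h. A *v ((B *v h - 0) - D (P *v (B *v w - q)) *v (P *v (B *v h - 0))))) (at w)"
      unfolding F_def by (intro blmul has_derivative_diff has_derivative_ident has_derivative_const)
    moreover have "(\<lambda>h. A *v ((B *v h - 0) - D (P *v (B *v w - q)) *v (P *v (B *v h - 0)))) =
        (*v) (A ** (B - D (P *v (B *v w - q)) ** (P ** B)))"
      by (simp add: fun_eq_iff matrix_vector_mult_diff_rdistrib flip: matrix_vector_mul_assoc)
    ultimately show ?thesis by simp
  qed
  have dG: "(G has_derivative (*v) (A ** (B + D (P *v (B *v w)) ** (P ** B)))) (at w)" if "w \<in> V" for w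
  proof -
    have v: "((\<lambda>w. B *v w) has_derivative (\<lambda>h. B *v h)) (at w)"
      by (intro blmul has_derivative_ident)
    have "P *v (B *v w) \<in> ball 0 \<rho>" using that by (simp add: V_def)
    from has_derivative_compose[OF blmul[OF v] D[OF this]] v
    have "(G has_derivative (\<lambda>h. A *v (0 + B *v h + D (P *v (B *v w)) *v (P *v (B *v h))))) (at w)"
      unfolding G_def by (intro blmul has_derivative_add has_derivative_ident has_derivative_const)
    moreover have "(\<lambda>h. A *v (0 + B *v h + D (P *v (B *v w)) *v (P *v (B *v h)))) =
        (*v) (A ** (B + D (P *v (B *v w)) ** (P ** B)))"
      by (simp add: fun_eq_iff matrix_vector_mult_add_rdistrib flip: matrix_vector_mul_assoc)
    ultimately show ?thesis by simp
  qed
  have BF: "B *v F w = B *v w - q - g (P *v (B *v w - q))" and BG: "B *v G w = q + B *v w + g (P *v (B *v w))" for w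
    by (simp_all add: F_def G_def BA)
  \<comment> \<open>Up to the shift by \<open>q\<close>, the maps \<open>F\<close> and
    \<open>G\<close> alter only the part killed by \<open>P\<close>, so both evaluate
    \<open>g\<close> at the same argument and are mutually inverse.\<close>
  have PBF: "P *v (B *v F w) = P *v (B *v w - q)" for w
    unfolding BF matrix_vector_mult_diff_distrib[of P "B *v w - q"] by (simp add: Pg)
  have PBG: "P *v (B *v G w - q) = P *v (B *v w)" for w
    by (simp add: BG matrix_vector_right_distrib Pg)
  have hom: "homeomorphism U V F G"
  proof (rule homeomorphismI)
    show "continuous_on U F" "continuous_on V G"
      by (auto intro!: continuous_at_imp_continuous_on has_derivative_continuous[OF dF]
          has_derivative_continuous[OF dG])
    show "F ` U \<subseteq> V" "G ` V \<subseteq> U"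
      by (auto simp: U_def V_def HB[unfolded mem_Collect_eq] PBF PBG) (simp_all add: BF BG cinner_simps q gd)
    show "G (F w) = w" for w
      unfolding G_def PBF unfolding BF by (simp add: AB)
    show "F (G w) = w" for w
      unfolding F_def PBG unfolding BG by (simp add: AB)
  qed
  define N0 where "N0 = {x. x \<in> ball 0 \<rho> \<and> P *v x = x \<and> cinner x d = 0}"
  have N: "?N = (\<lambda>x. A *v (q + x + g x)) ` N0"
    by (auto simp: N0_def)
  have FN0: "F (A *v (q + x + g x)) = A *v x" and N0U: "A *v (q + x + g x) \<in> U" if "x \<in> N0" for x
  proof -
    have x: "P *v (x + g x) = x" "norm x < \<rho>" "cinner x d = 0"
      using that by (simp_all add: N0_def matrix_vector_right_distrib Pg)
    then show "F (A *v (q + x + g x)) = A *v x"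
      by (simp add: F_def BA add.assoc)
    show "A *v (q + x + g x) \<in> U"
      using x by (simp add: U_def H BA cinner_simps q gd add.assoc)
  qed
  have NU: "?N \<subseteq> U"
    unfolding N using N0U by auto
  have FN: "F ` (?N \<inter> U) = L \<inter> V"
  proof -
    have "L \<inter> V = (*v) A ` N0"
      by (auto simp: L_def V_def N0_def L0_def BA H)
    moreover have "F ` (?N \<inter> U) = (\<lambda>x. F (A *v (q + x + g x))) ` N0"
      unfolding Int_absorb2[OF NU] unfolding N image_image ..
    moreover have "\<dots> = (*v) A ` N0"
      by (rule image_cong[OF refl FN0])
    ultimately show ?thesis by simp
  qed
  show ?thesis
    unfolding complex_submanifold_def
  proof (intro conjI ballI)
    show "?N \<subseteq> ?H" using NU by (auto simp: U_def)
    fix w assume "w \<in> ?N"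
    then have wU: "w \<in> U" using NU by blast
    show "\<exists>U V L F G. w \<in> U \<and> openin (top_of_set ?H) U \<and> openin (top_of_set ?H) V \<and>
       vec.subspace L \<and> L \<subseteq> ?H \<and> vec.dim L = m - 1 \<and>
       homeomorphism U V F G \<and> holomorphic_map_on F U \<and> holomorphic_map_on G V \<and>
       F ` (?N \<inter> U) = L \<inter> V"
      by (rule exI[of _ U], rule exI[of _ V], rule exI[of _ L], rule exI[of _ F], rule exI[of _ G],
          intro conjI wU opU opV sL LH dimL hom holomorphic_map_onI[OF dF] holomorphic_map_onI[OF dG] FN)
  qed (rule sH)
qed

text \<open>A point of \<open>M\<close> near \<open>p\<close> has a parameter
  \<open>x + c *s d\<close> with \<open>x\<close> orthogonal to \<open>d\<close>, and by invariance
  \<open>g\<close> takes the same value there as at \<open>x\<close>. So the coefficient of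
  \<open>d\<close> is free and the rest of the point lies in \<open>N0\<close>.\<close>

lemma tangent_direction_imp_extrinsic_product:
  fixes M :: "(complex^'n) set"
  assumes M: "complex_submanifold UNIV m M" and d: "d \<noteq> 0"
    and tangent: "\<And>z. z \<in> M \<Longrightarrow> d \<in> tangent_space M z"
  shows "locally_extrinsic_product m M d"
proof -
  obtain A i \<alpha> where A: "unitary A" and \<alpha>: "\<alpha> \<noteq> 0" and Ad: "A *v d = \<alpha> *s axis i 1"
    by (rule Householder_reflection[OF d]) (rule that)
  define B where "B = conjugate_transpose A"
  have AB: "A *v (B *v x) = x" and BA: "B *v (A *v x) = x" for x
    using A by (simp_all add: B_def unitary_def matrix_vector_mul_assoc)
  have Acd: "A *v (c *s d) = axis i (c * \<alpha>)" for c
    by (simp add: vector_scalar_commute Ad vec_eq_iff axis_def)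
  have H: "(A *v v) $ i = 0 \<longleftrightarrow> cinner v d = 0" for v
  proof -
    have "cinner v d = cinner (A *v v) (A *v d)"
      by (simp add: cinner_adjoint flip: B_def) (simp add: BA)
    also have "\<dots> = cnj \<alpha> * (A *v v) $ i"
      by (simp add: Ad cinner_scale_right cinner_axis)
    finally show ?thesis using \<alpha> by simp
  qed
  have span: "(*v) A ` vec.span {d} = vec.span {axis i 1}"
  proof -
    have "(*v) A ` vec.span {d} = range (\<lambda>c. axis i (c * \<alpha>))"
      by (simp add: vec.span_singleton image_image Acd)
    also have "\<dots> = range (\<lambda>c. axis i c)"
    proof (intro subset_antisym subsetI)
      fix y assume "y \<in> range (\<lambda>c. axis i c :: complex^'n)"
      then obtain c where "y = axis i (c / \<alpha> * \<alpha>)" using \<alpha> by auto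
      then show "y \<in> range (\<lambda>c. axis i (c * \<alpha>))" by (rule image_eqI) simp
    qed auto
    also have "\<dots> = vec.span {axis i 1}"
    proof -
      have ax: "c *s axis i 1 = axis i c" for c :: complex
        by (simp add: vec_eq_iff axis_def)
      show ?thesis unfolding vec.span_singleton ax ..
    qed
    finally show ?thesis .
  qed
  have "\<exists>W N. open W \<and> A *v p \<in> W \<and> complex_submanifold {w. w $ i = 0} (m - 1) N \<and>
         (*v) A ` M \<inter> W = {axis i c + w | c w. w \<in> N} \<inter> W" if p: "p \<in> M" for p
  proof -
    obtain P \<rho> g W0 where chart: "graph_chart M p P \<rho> g W0" and dim: "vec.dim (range ((*v) P)) = m"
      by (rule complex_submanifold_graph_chart[OF M p]) (rule that)
    from chart have W0: "open W0" "p \<in> W0" and P: "P ** P = P"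
      and Pg: "\<And>x. P *v g x = 0"
      and Wb: "\<And>z. z \<in> W0 \<Longrightarrow> norm (P *v (z - p)) < \<rho>"
      and WM: "\<And>z. z \<in> W0 \<Longrightarrow> z \<in> M \<longleftrightarrow> z - p = P *v (z - p) + g (P *v (z - p))"
      unfolding graph_chart_def by auto
    have PP: "P *v (P *v x) = P *v x" for x
      using P by (simp add: matrix_vector_mul_assoc)
    note inv = graph_chart_invariant[OF chart tangent]
    have Pd: "P *v (c *s d) = c *s d" for c
      using inv(1) by (simp add: vector_scalar_commute)
    \<comment> \<open>\<open>c0\<close> is the coefficient of \<open>d\<close> in \<open>p\<close>;
      removing it places the factor in the hyperplane orthogonal to \<open>d\<close>, and it is put
      back into the axis coordinate.\<close>
    define c0 where "c0 = cinner p d / cinner d d"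
    define q where "q = p - c0 *s d"
    have q: "cinner q d = 0"
      using d by (simp add: q_def c0_def cinner_simps)
    define N0 where "N0 = {q + x + g x | x. x \<in> ball 0 \<rho> \<and> P *v x = x \<and> cinner x d = 0}"
    define W where "W = (*v) B -` W0"
    have "open W"
      unfolding W_def by (intro open_vimage W0 linear_continuous_on matrix_vector_mul_bounded_linear)
    moreover have "A *v p \<in> W"
      using W0 by (simp add: W_def BA)
    moreover have "complex_submanifold {w. w $ i = 0} (m - 1) ((*v) A ` N0)"
      unfolding N0_def by (rule extrinsic_product_factor[OF chart A inv(1) d H q dim])
    moreover have "(*v) A ` M \<inter> W = {axis i c + w | c w. w \<in> (*v) A ` N0} \<inter> W"
    proof (intro subset_antisym subsetI)
      fix y assume "y \<in> (*v) A ` M \<inter> W"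
      then obtain z where z: "z \<in> M" "z \<in> W0" "y = A *v z" and yW: "y \<in> W"
        by (auto simp: W_def BA)
      define u where "u = P *v (z - p)"
      define c where "c = cinner u d / cinner d d"
      define x where "x = u - c *s d"
      have u: "z - p = u + g u" "norm u < \<rho>" "P *v u = u"
        using WM[OF z(2)] Wb[OF z(2)] z(1) by (simp_all add: u_def PP)
      have x: "P *v x = x" "cinner x d = 0" "u = x + c *s d"
        using d by (simp_all add: x_def matrix_vector_mult_diff_distrib u Pd cinner_simps c_def)
      \<comment> \<open>Pythagoras keeps \<open>x\<close> inside the parameter ball; invariance of
        \<open>g\<close> is available only between points of the ball.\<close>
      have "norm x \<le> norm u"
      proof -
        have "orthogonal x (c *s d)"
          using x(2) Re_cinner[of x "c *s d"] by (simp add: orthogonal_def cinner_scale_right)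
        then have "norm u ^ 2 = norm x ^ 2 + norm (c *s d) ^ 2"
          unfolding x(3) by (rule norm_add_Pythagorean)
        then show ?thesis
          using power2_le_imp_le[of "norm x" "norm u"] by simp
      qed
      then have xb: "x \<in> ball 0 \<rho>" "x + c *s d \<in> ball 0 \<rho>" using u(2) x(3) by auto
      have "g u = g x"
        using inv(2)[OF _ xb] x(3) by simp
      then have "z = (c0 + c) *s d + (q + x + g x)"
        using u(1) x(3) by (simp add: q_def algebra_simps vec.scale_left_distrib)
      then have "y = axis i ((c0 + c) * \<alpha>) + A *v (q + x + g x)"
        unfolding z(3) by (simp only: matrix_vector_right_distrib Acd)
      moreover have "q + x + g x \<in> N0"
        using x xb by (auto simp: N0_def)
      ultimately show "y \<in> {axis i c + w | c w. w \<in> (*v) A ` N0} \<inter> W"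
        using yW by blast
    next
      fix y assume "y \<in> {axis i c + w | c w. w \<in> (*v) A ` N0} \<inter> W"
      then obtain c x where y: "y = axis i c + A *v (q + x + g x)" "y \<in> W"
        and x: "x \<in> ball 0 \<rho>" "P *v x = x" "cinner x d = 0"
        by (auto simp: N0_def)
      define z where "z = (c / \<alpha>) *s d + (q + x + g x)"
      have yz: "y = A *v z"
        using \<alpha> by (simp add: z_def y(1) matrix_vector_right_distrib[of A "(c / \<alpha>) *s d"] Acd)
      define c1 where "c1 = c / \<alpha> - c0"
      have zW: "z \<in> W0" using y(2) by (simp add: yz W_def BA)
      have zp: "z - p = x + c1 *s d + g x"
        by (simp add: z_def q_def c1_def vec.scale_left_diff_distrib)
      then have Pz: "P *v (z - p) = x + c1 *s d"
        by (simp add: matrix_vector_right_distrib x Pd Pg)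
      \<comment> \<open>Here \<open>x\<close> is in the ball from the start; that the shifted
        parameter is there too comes from \<open>z\<close> being in \<open>W0\<close>.\<close>
      then have "g (x + c1 *s d) = g x"
        using inv(2)[OF _ x(1), of c1] Wb[OF zW] by simp
      then have "z \<in> M"
        using WM[OF zW] zp Pz by simp
      then show "y \<in> (*v) A ` M \<inter> W"
        using y(2) yz by blast
    qed
    ultimately show ?thesis
      by (intro exI[of _ W] exI[of _ "(*v) A ` N0"] conjI)
  qed
  then show ?thesis
    unfolding locally_extrinsic_product_def using A span by (intro exI[of _ A] exI[of _ i] conjI ballI)
qed

theorem theorem1p2:
  fixes M :: "(complex^'n) set" and d :: "complex^'n" and m :: nat and \<theta> :: real
  assumes "complex_submanifold UNIV m M"
    and "connected M"
    and "full M"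
    and "d \<noteq> 0"
    and "helix M \<theta> d"
  shows "\<theta> = 0 \<and> locally_extrinsic_product m M d"
proof
  show "\<theta> = 0"
    using full_helix_direction_tangent(2) assms by blast
  show "locally_extrinsic_product m M d"
    using full_helix_direction_tangent(1) assms by (intro tangent_direction_imp_extrinsic_product) blast+
qed

end
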